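(* The parameterized problem HS$(n-k,k+d)$ admits a kernel with fewer than $(d+1)k$ vertices and fewer than $d(d+1)k$ edges; that is, there is a polynomial-time algorithm that, given an instance $(H,k)$ where $H$ has degeneracy $d$, outputs an equivalent instance whose hypergraph has fewer than $(d+1)k$ vertices and fewer than $d(d+1)k$ edges.
   Context: A hypergraph $H=(V,\mathcal F)$ has a nonempty finite vertex set $V$, $n=|V|$, and a family $\mathcal F$ of nonempty subsets of $V$ (edges), parallel edges allowed; the degree of $v$ is the number of edges containing $v$. For $X\subset V$, $H\circleddash X$ is obtained from $H$ by deleting the set $\mathcal E$ of all edges that intersect $X$ together with all vertices contained only in edges of $\mathcal E$. $H$ is $d$-degenerate if for every $X\subset V$, $H\circleddash X$ contains a vertex of degree at most $d$; the degeneracy of $H$ is the least such $d$. A hitting set is a set of vertices meeting every edge. HS$(n-k,k+d)$: given a hypergraph $H$ and integer $k$, with parameter $k+d$ where $d$ is the degeneracy of $H$, decide whether $H$ has a hitting set of size at most $n-k$.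
   Formalization: k is a natural number; since a hypergraph has a nonempty vertex set, the bound of fewer than (d+1)k vertices is claimed only when (d+1)k > 1, and the bound of fewer than d(d+1)k edges only when d(d+1)k > 0, as otherwise no hypergraph can satisfy them. *)

theory Defs
  imports "HOL-Library.Multiset" "HOL-Library.Log_Nat" "HOL-Computational_Algebra.Polynomial"
begin

section \<open>Hypergraphs\<close>

record 'a hypergraph =
  verts :: "'a set"
  edges :: "'a set multiset"  \<comment> \<open>a multiset, since parallel edges are allowed\<close>

definition is_hypergraph :: "'a hypergraph \<Rightarrow> bool" where
  "is_hypergraph H \<longleftrightarrow> finite (verts H) \<and> verts H \<noteq> {} \<and>
     (\<forall>e \<in># edges H. e \<noteq> {} \<and> e \<subseteq> verts H)"

definition vdegree :: "'a hypergraph \<Rightarrow> 'a \<Rightarrow> nat" where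
  "vdegree H v = size {#e \<in># edges H. v \<in> e#}"

text \<open>A vertex lying in no edge at all is, vacuously, contained only in edges meeting \<open>X\<close> and is
  therefore deleted for every \<open>X\<close>; the members of \<open>X\<close> are always deleted. If isolated vertices
  outside \<open>X\<close> were kept instead, the degeneracy below would be the same number.\<close>

definition hyper_minus :: "'a hypergraph \<Rightarrow> 'a set \<Rightarrow> 'a hypergraph" (infixl "\<ominus>" 65) where
  "H \<ominus> X = \<lparr> verts = verts H - {v. \<forall>e \<in># edges H. v \<in> e \<longrightarrow> e \<inter> X \<noteq> {}},
              edges = {#e \<in># edges H. e \<inter> X = {}#} \<rparr>"

text \<open>Sets \<open>X\<close> for which nothing remains (such as \<open>X = verts H\<close>) impose no condition; otherwise
  no hypergraph would be \<open>d\<close>-degenerate.\<close>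

definition degenerate :: "nat \<Rightarrow> 'a hypergraph \<Rightarrow> bool" where
  "degenerate d H \<longleftrightarrow> (\<forall>X \<subseteq> verts H. verts (H \<ominus> X) \<noteq> {} \<longrightarrow>
     (\<exists>v \<in> verts (H \<ominus> X). vdegree (H \<ominus> X) v \<le> d))"

definition degeneracy :: "'a hypergraph \<Rightarrow> nat" where
  "degeneracy H = (LEAST d. degenerate d H)"

definition hitting_set :: "'a hypergraph \<Rightarrow> 'a set \<Rightarrow> bool" where
  "hitting_set H S \<longleftrightarrow> S \<subseteq> verts H \<and> (\<forall>e \<in># edges H. S \<inter> e \<noteq> {})"


section \<open>Machine model\<close>

text \<open>Programs of a random access machine in structured form. The store consists of named unbounded
  arrays of natural numbers, of which a program can mention only finitely many; scalar variables
  are cells 0. The sole arithmetic operations are addition and truncated subtraction, and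
  evaluating an expression costs as many steps as it has nodes. Hence an operation lengthens the
  largest number in the store by at most one bit (up to constants of the program), so that running
  times polynomial in the bit length of the input are the same as for Turing machines.\<close>

type_synonym state = "string \<Rightarrow> nat \<Rightarrow> nat"

datatype exp = Const nat | Read string exp | Plus exp exp | Minus exp exp

datatype com =
    Skip
  | Write string exp exp  \<comment> \<open>\<open>Write x i a\<close>: cell \<open>i\<close> of array \<open>x\<close> becomes \<open>a\<close>\<close>
  | Seq com com
  | If exp com com
  | While exp com

fun val :: "exp \<Rightarrow> state \<Rightarrow> nat" where
  "val (Const c) s = c"
| "val (Read x i) s = s x (val i s)"
| "val (Plus a b) s = val a s + val b s"
| "val (Minus a b) s = val a s - val b s"

fun cost :: "exp \<Rightarrow> nat" where
  "cost (Const c) = 1"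
| "cost (Read x i) = 1 + cost i"
| "cost (Plus a b) = 1 + cost a + cost b"
| "cost (Minus a b) = 1 + cost a + cost b"

text \<open>\<open>exec c s t s'\<close>: started in state \<open>s\<close>, \<open>c\<close> halts after \<open>t\<close> steps in state \<open>s'\<close>.\<close>

inductive exec :: "com \<Rightarrow> state \<Rightarrow> nat \<Rightarrow> state \<Rightarrow> bool" where
  Skip: "exec Skip s 1 s"
| Write: "exec (Write x i a) s (1 + cost i + cost a) (s(x := (s x)(val i s := val a s)))"
| Seq: "exec c1 s t1 s1 \<Longrightarrow> exec c2 s1 t2 s2 \<Longrightarrow> exec (Seq c1 c2) s (1 + t1 + t2) s2"
| IfTrue: "val b s \<noteq> 0 \<Longrightarrow> exec c1 s t s1 \<Longrightarrow> exec (If b c1 c2) s (1 + cost b + t) s1"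
| IfFalse: "val b s = 0 \<Longrightarrow> exec c2 s t s1 \<Longrightarrow> exec (If b c1 c2) s (1 + cost b + t) s1"
| WhileFalse: "val b s = 0 \<Longrightarrow> exec (While b c) s (1 + cost b) s"
| WhileTrue: "val b s \<noteq> 0 \<Longrightarrow> exec c s t1 s1 \<Longrightarrow> exec (While b c) s1 t2 s2 \<Longrightarrow>
    exec (While b c) s (1 + cost b + t1 + t2) s2"

inductive_cases SkipE: "exec Skip s t s'"
inductive_cases WriteE: "exec (Write x i a) s t s'"
inductive_cases SeqE: "exec (Seq c1 c2) s t s'"
inductive_cases IfE: "exec (If b c1 c2) s t s'"
inductive_cases WhileE: "exec (While b c) s t s'"

lemma exec_deterministic:
  "exec c s t s1 \<Longrightarrow> exec c s t' s2 \<Longrightarrow> t' = t \<and> s2 = s1"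
proof (induction arbitrary: t' s2 rule: exec.induct)
  case (Skip s)
  then show ?case by (auto elim: SkipE)
next
  case (Write x i a s)
  then show ?case by (auto elim: WriteE)
next
  case (Seq c1 s t1 s1 c2 t2 s3)
  from Seq.prems show ?case
  proof (rule SeqE)
    fix t3 s4 t4
    assume *: "t' = Suc (t3 + t4)" "exec c1 s t3 s4" "exec c2 s4 t4 s2"
    from Seq.IH(1)[OF *(2)] have "t3 = t1" "s4 = s1" by simp_all
    with Seq.IH(2)[of t4 s2] * show ?thesis by simp
  qed
next
  case (IfTrue b s c1 t s1 c2)
  from IfTrue.prems show ?case by (rule IfE) (use IfTrue.hyps(1) in \<open>auto dest: IfTrue.IH\<close>)
next
  case (IfFalse b s c2 t s1 c1)
  from IfFalse.prems show ?case by (rule IfE) (use IfFalse.hyps(1) in \<open>auto dest: IfFalse.IH\<close>)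
next
  case (WhileFalse b s c)
  from WhileFalse.prems show ?case by (rule WhileE) (use WhileFalse.hyps in simp_all)
next
  case (WhileTrue b s c t1 s1 t2 s3)
  from WhileTrue.prems show ?case
  proof (rule WhileE)
    fix t3 s4 t4
    assume *: "t' = Suc (cost b + t3 + t4)" "exec c s t3 s4" "exec (While b c) s4 t4 s2"
    from WhileTrue.IH(1)[OF *(2)] have "t3 = t1" "s4 = s1" by simp_all
    with WhileTrue.IH(2)[of t4 s2] * show ?thesis by simp
  qed (use WhileTrue.hyps(1) in simp_all)
qed

definition input_state :: "nat list \<Rightarrow> state" where
  "input_state xs = (\<lambda>x i.
     if x = ''len'' \<and> i = 0 then length xs
     else if x = ''io'' \<and> i < length xs then xs ! i
     else 0)"

definition output_of :: "state \<Rightarrow> nat list" where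
  "output_of s = map (s ''io'') [0..<s ''len'' 0]"

text \<open>\<open>floorlog 2 x\<close> is the number of binary digits of \<open>x\<close>; every list entry counts one more for a
  separator.\<close>

definition bit_size :: "nat list \<Rightarrow> nat" where
  "bit_size xs = (\<Sum>x\<leftarrow>xs. floorlog 2 x + 1)"

text \<open>The length of the output is charged to the running time, because a program could declare an
  output longer than the part of the store it has written.\<close>

definition polytime_on :: "com \<Rightarrow> nat list set \<Rightarrow> bool" where
  "polytime_on c D \<longleftrightarrow> (\<exists>p :: nat poly. \<forall>xs \<in> D. \<exists>t s.
     exec c (input_state xs) t s \<and> t + bit_size (output_of s) \<le> poly p (bit_size xs))"


section \<open>Parameterized problems and kernels\<close>

record 'i param_problem =
  instances :: "'i set"
  yes_instances :: "'i set"
  parameter :: "'i \<Rightarrow> nat"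
  codes :: "'i \<Rightarrow> nat list set"  \<comment> \<open>all admissible encodings of an instance\<close>

text \<open>\<open>B I I'\<close> is an additional guarantee relating an instance and its kernel.\<close>

definition kernelization :: "'i param_problem \<Rightarrow> ('i \<Rightarrow> 'i \<Rightarrow> bool) \<Rightarrow> com \<Rightarrow> bool" where
  "kernelization P B c \<longleftrightarrow>
     polytime_on c (\<Union>I \<in> instances P. codes P I) \<and>
     (\<exists>f g :: nat \<Rightarrow> nat. \<forall>I \<in> instances P. \<forall>xs \<in> codes P I. \<exists>t s. \<exists>I' \<in> instances P.
        exec c (input_state xs) t s \<and> output_of s \<in> codes P I' \<and>
        (I \<in> yes_instances P \<longleftrightarrow> I' \<in> yes_instances P) \<and>
        parameter P I' \<le> f (parameter P I) \<and>
        bit_size (output_of s) \<le> g (parameter P I) \<and>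
        B I I')"


section \<open>Hitting sets of size at most n - k\<close>

text \<open>An instance is written as \<open>k\<close>, the numbers of vertices and edges, and the incidence matrix
  with respect to some ordering of the vertices and some ordering of the edges.\<close>

definition hs_codes :: "'a hypergraph \<times> nat \<Rightarrow> nat list set" where
  "hs_codes = (\<lambda>(H, k).
     {[k, length vs, length es] @ concat (map (\<lambda>e. map (\<lambda>v. of_bool (v \<in> e)) vs) es) | vs es.
        distinct vs \<and> set vs = verts H \<and> mset es = edges H})"

text \<open>The size condition is stated over the integers, so for \<open>k > n\<close> the answer is no. Vertices are
  natural numbers only for definiteness; up to renaming, every hypergraph is of this kind.\<close>

definition hs_problem :: "(nat hypergraph \<times> nat) param_problem" where
  "hs_problem = \<lparr>
     instances = {(H, k). is_hypergraph H},
     yes_instances = {(H, k). is_hypergraph H \<and>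
       (\<exists>S. hitting_set H S \<and> int (card S) \<le> int (card (verts H)) - int k)},
     parameter = (\<lambda>(H, k). k + degeneracy H),
     codes = hs_codes \<rparr>"

end

theory Submission
  imports Defs
begin

text \<open>The vertex of an edge of size one lies in every hitting set, so it may be deleted together with
  all edges through it. In what remains, every edge has at least two vertices. Now repeatedly take a
  vertex \<open>u\<close> of minimum positive degree, which is at most \<open>d\<close>, and put one further vertex of each edge at
  \<open>u\<close> into the set \<open>X\<close> of killed vertices, dropping the edges thus hit. At most \<open>d\<close> vertices are killed
  for each vertex that stays alive for good, so \<open>X\<close> becomes a hitting set whose complement contains at
  least a fraction \<open>1 / (d + 1)\<close> of the remaining vertices. If this complement has at least \<open>k\<close> vertices,
  the answer is yes; otherwise fewer than \<open>(d + 1) k\<close> vertices remain, and removing vertices of degree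
  at most \<open>d\<close> one by one bounds the number of edges. The procedure does not need to know \<open>d\<close>.\<close>


section \<open>Loop programs\<close>

text \<open>Singleton edges are the obstacle to the greedy step: to hit an edge at \<open>u\<close>
  while keeping \<open>u\<close> alive, a second vertex must be available. Once the singletons are
  hit, the obstacle cannot return, because an edge that survives has lost no vertex. The degree
  bound is always that of the original hypergraph: every state of the greedy phase is, up to
  isolated vertices, \<open>H \<ominus> X\<close> with \<open>X\<close> containing the deleted set
  \<open>Z\<close>, so the degeneracy of \<open>H\<close> applies directly. Charging killed vertices
  to freed ones gives \<open>card (X - Z) \<le> d * (n - card X)\<close>; adding
  \<open>n - card X\<close> yields \<open>n - card Z \<le> (d + 1) * (n - card X)\<close>, the
  origin of the factor \<open>d + 1\<close>. The set \<open>X\<close> only serves to detect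
  yes-instances; the kernel is \<open>H\<close> without \<open>Z\<close>, with the same
  \<open>k\<close>, and its parameter is bounded through its number of edges. Since \<open>k\<close>
  may be exponential in the length of the input, loops run over vertices and edges only.\<close>

text \<open>\<open>For i x p\<close> runs \<open>p\<close> with \<open>i = 0, 1, \<dots>\<close> below the value of \<open>x\<close>. As long as loop bounds and loop
  counters are not overwritten, such programs have a total functional semantics and a running time
  that can be read off their syntax, so that correctness can be shown without counting steps.\<close>

datatype loop =
    Nop
  | Assign string exp exp
  | Then loop loop (infixr \<open>;;\<close> 60)
  | Cond exp loop loop
  | For string string loop

abbreviation V :: "string \<Rightarrow> exp" where
  "V x \<equiv> Read x (Const 0)"

abbreviation Put :: "string \<Rightarrow> exp \<Rightarrow> loop" (infix \<open>:=:\<close> 65) where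
  "x :=: a \<equiv> Assign x (Const 0) a"

abbreviation set0 :: "string \<Rightarrow> nat \<Rightarrow> state \<Rightarrow> state" where
  "set0 x j s \<equiv> s(x := (s x)(0 := j))"

fun compile :: "loop \<Rightarrow> com" where
  "compile Nop = Skip"
| "compile (Assign x i a) = Write x i a"
| "compile (p ;; q) = Seq (compile p) (compile q)"
| "compile (Cond b p q) = If b (compile p) (compile q)"
| "compile (For i x p) = Seq (Write i (Const 0) (Const 0))
     (While (Minus (V x) (V i)) (Seq (compile p) (Write i (Const 0) (Plus (V i) (Const 1)))))"

text \<open>The fold writes back its own index instead of incrementing the counter; the two agree
  when the body leaves the counter alone.\<close>

fun run :: "loop \<Rightarrow> state \<Rightarrow> state" where
  "run Nop s = s"
| "run (Assign x i a) s = s(x := (s x)(val i s := val a s))"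
| "run (p ;; q) s = run q (run p s)"
| "run (Cond b p q) s = (if val b s \<noteq> 0 then run p s else run q s)"
| "run (For i x p) s = fold (\<lambda>j s. set0 i (Suc j) (run p s)) [0..<s x 0] (set0 i 0 s)"

fun writes :: "loop \<Rightarrow> string set" where
  "writes Nop = {}"
| "writes (Assign x i a) = {x}"
| "writes (p ;; q) = writes p \<union> writes q"
| "writes (Cond b p q) = writes p \<union> writes q"
| "writes (For i x p) = insert i (writes p)"

fun bounds :: "loop \<Rightarrow> string set" where
  "bounds (p ;; q) = bounds p \<union> bounds q"
| "bounds (Cond b p q) = bounds p \<union> bounds q"
| "bounds (For i x p) = insert x (bounds p)"
| "bounds _ = {}"

fun wf_loop :: "loop \<Rightarrow> bool" where
  "wf_loop (p ;; q) \<longleftrightarrow> wf_loop p \<and> wf_loop q"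
| "wf_loop (Cond b p q) \<longleftrightarrow> wf_loop p \<and> wf_loop q"
| "wf_loop (For i x p) \<longleftrightarrow> wf_loop p \<and> i \<notin> writes p"
| "wf_loop _ \<longleftrightarrow> True"

text \<open>\<open>B\<close> bounds all loop limits. The failing test of a loop costs 6 and the
  initialisation of the counter 4, together 10. Each round adds 6 for the test and 7 for sequencing
  and incrementing, hence 13.\<close>

fun time :: "nat \<Rightarrow> loop \<Rightarrow> nat" where
  "time B Nop = 1"
| "time B (Assign x i a) = 1 + cost i + cost a"
| "time B (p ;; q) = 1 + time B p + time B q"
| "time B (Cond b p q) = 1 + cost b + time B p + time B q"
| "time B (For i x p) = 10 + B * (13 + time B p)"

lemma run_frame: "y \<notin> writes p \<Longrightarrow> run p s y = s y"
proof (induction p arbitrary: s)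
  case (For i x p)
  have "fold (\<lambda>j s. set0 i (Suc j) (run p s)) js s y = s y" for js s
    by (induction js arbitrary: s) (use For in auto)
  with For show ?case by simp
qed auto

lemma fold_upt_invariant:
  assumes "I 0 s" and "\<And>j s. j < N \<Longrightarrow> I j s \<Longrightarrow> I (Suc j) (f j s)"
  shows "I N (fold f [0..<N] s)"
  using assms by (induction N) auto

text \<open>Each round is handed the counter value and the frame condition, so an invariant
  \<open>I\<close> has to speak only about what the body changes; \<open>?J\<close> carries these
  facts through the fold.\<close>

lemma run_For:
  assumes "I 0 (set0 i 0 s)"
    and step: "\<And>j s'. \<lbrakk>j < s x 0; s' i 0 = j; \<And>y. y \<notin> insert i (writes p) \<Longrightarrow> s' y = s y; I j s'\<rbrakk>
      \<Longrightarrow> I (Suc j) (set0 i (Suc j) (run p s'))"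
  shows "I (s x 0) (run (For i x p) s)"
proof -
  let ?J = "\<lambda>j s'. s' i 0 = j \<and> (\<forall>y. y \<notin> insert i (writes p) \<longrightarrow> s' y = s y) \<and> I j s'"
  have "?J (s x 0) (fold (\<lambda>j s. set0 i (Suc j) (run p s)) [0..<s x 0] (set0 i 0 s))"
  proof (rule fold_upt_invariant[where I = ?J])
    show "?J 0 (set0 i 0 s)" using assms(1) by simp
    show "?J (Suc j) (set0 i (Suc j) (run p s'))" if "j < s x 0" "?J j s'" for j s'
      using that step[of j s'] by (simp add: run_frame)
  qed
  then show ?thesis by simp
qed

lemma exec_compile:
  assumes "wf_loop p" "bounds p \<inter> writes p = {}" "\<forall>x \<in> bounds p. s x 0 \<le> B"
  shows "\<exists>t \<le> time B p. exec (compile p) s t (run p s)"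
  using assms
proof (induction p arbitrary: s)
  case Nop
  show ?case using exec.Skip[of s] by (intro exI[of _ 1]) simp
next
  case (Assign x i a)
  show ?case
    unfolding compile.simps run.simps time.simps by (rule exI, rule conjI[OF order_refl exec.Write])
next
  case (Then p q)
  obtain t1 where t1: "t1 \<le> time B p" "exec (compile p) s t1 (run p s)"
    using Then.IH(1)[of s] Then.prems by auto
  have "\<forall>x \<in> bounds q. run p s x 0 \<le> B"
  proof
    fix x assume x: "x \<in> bounds q"
    with Then.prems(2) have "x \<notin> writes p" by auto
    from run_frame[OF this] x Then.prems(3) show "run p s x 0 \<le> B" by simp
  qed
  then obtain t2 where t2: "t2 \<le> time B q" "exec (compile q) (run p s) t2 (run q (run p s))"
    using Then.IH(2)[of "run p s"] Then.prems by auto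
  have "exec (compile (p ;; q)) s (1 + t1 + t2) (run (p ;; q) s)"
    using exec.Seq[OF t1(2) t2(2)] by simp
  moreover have "1 + t1 + t2 \<le> time B (p ;; q)" using t1 t2 by simp
  ultimately show ?case by blast
next
  case (Cond b p q)
  show ?case
  proof (cases "val b s = 0")
    case True
    obtain t where t: "t \<le> time B q" "exec (compile q) s t (run q s)"
      using Cond.IH(2)[of s] Cond.prems by auto
    have "exec (compile (Cond b p q)) s (1 + cost b + t) (run (Cond b p q) s)"
      using exec.IfFalse[OF True t(2)] True by simp
    moreover have "1 + cost b + t \<le> time B (Cond b p q)" using t by simp
    ultimately show ?thesis by blast
  next
    case False
    obtain t where t: "t \<le> time B p" "exec (compile p) s t (run p s)"
      using Cond.IH(1)[of s] Cond.prems by auto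
    have "exec (compile (Cond b p q)) s (1 + cost b + t) (run (Cond b p q) s)"
      using exec.IfTrue[OF False t(2)] False by simp
    moreover have "1 + cost b + t \<le> time B (Cond b p q)" using t by simp
    ultimately show ?thesis by blast
  qed
next
  case (For i x p)
  let ?b = "Minus (V x) (V i)"
  let ?c = "Seq (compile p) (Write i (Const 0) (Plus (V i) (Const 1)))"
  let ?f = "\<lambda>j s. set0 i (Suc j) (run p s)"
  have xi: "x \<noteq> i" "x \<notin> writes p" "i \<notin> writes p" using For.prems by auto
  \<comment> \<open>Induction on the number \<open>k\<close> of remaining rounds; the 6 pays for the
    final failing test.\<close>
  have loop: "\<exists>t \<le> 6 + k * (13 + time B p). exec (While ?b ?c) s' t (fold ?f [j..<N] s')"
    if "s' x 0 = N" "s' i 0 = j" "j \<le> N" "N - j = k" "\<forall>y \<in> bounds p. s' y 0 \<le> B" for s' j k N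
    using that
  proof (induction k arbitrary: j s')
    case 0
    then have "exec (While ?b ?c) s' (1 + cost ?b) s'" by (intro exec.WhileFalse) simp
    moreover have "1 + cost ?b \<le> 6 + 0 * (13 + time B p)" by simp
    moreover have "fold ?f [j..<N] s' = s'" using 0 by simp
    ultimately show ?case by metis
  next
    case (Suc k)
    obtain t where t: "t \<le> time B p" "exec (compile p) s' t (run p s')"
      using For.IH[of s'] For.prems Suc.prems by auto
    have w: "exec (Write i (Const 0) (Plus (V i) (Const 1))) (run p s') 6 (?f j s')"
      using exec.Write[of i "Const 0" "Plus (V i) (Const 1)" "run p s'"] Suc.prems xi
      by (simp add: run_frame eval_nat_numeral)
    have body: "exec ?c s' (1 + t + 6) (?f j s')" by (rule exec.Seq[OF t(2) w])
    have "\<exists>t' \<le> 6 + k * (13 + time B p).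
        exec (While ?b ?c) (?f j s') t' (fold ?f [Suc j..<N] (?f j s'))"
    proof (rule Suc.IH)
      show "\<forall>y \<in> bounds p. ?f j s' y 0 \<le> B"
      proof
        fix y assume y: "y \<in> bounds p"
        with For.prems(2) have "y \<notin> writes p" "y \<noteq> i" by auto
        with run_frame[of y p s'] y Suc.prems(5) show "?f j s' y 0 \<le> B" by simp
      qed
    qed (use Suc.prems xi in \<open>simp_all add: run_frame\<close>)
    then obtain t' where t': "t' \<le> 6 + k * (13 + time B p)"
      "exec (While ?b ?c) (?f j s') t' (fold ?f [Suc j..<N] (?f j s'))" by blast
    have "val ?b s' \<noteq> 0" using Suc.prems by simp
    from exec.WhileTrue[OF this body t'(2)]
    have "exec (While ?b ?c) s' (1 + cost ?b + (1 + t + 6) + t') (fold ?f [j..<N] s')"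
      using Suc.prems by (simp add: upt_conv_Cons)
    moreover have "1 + cost ?b + (1 + t + 6) + t' \<le> 6 + Suc k * (13 + time B p)"
      using t(1) t'(1) by simp
    ultimately show ?case by blast
  qed
  have "\<exists>t \<le> 6 + s x 0 * (13 + time B p).
      exec (While ?b ?c) (set0 i 0 s) t (fold ?f [0..<s x 0] (set0 i 0 s))"
    by (rule loop) (use xi For.prems in \<open>auto simp: disjoint_iff\<close>)
  then obtain t where t: "t \<le> 6 + s x 0 * (13 + time B p)"
    "exec (While ?b ?c) (set0 i 0 s) t (fold ?f [0..<s x 0] (set0 i 0 s))" by blast
  have "exec (Write i (Const 0) (Const 0)) s 3 (set0 i 0 s)"
    using exec.Write[of i "Const 0" "Const 0" s] by (simp add: eval_nat_numeral)
  from exec.Seq[OF this t(2)]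
  have "exec (compile (For i x p)) s (1 + 3 + t) (run (For i x p) s)" by simp
  moreover have "s x 0 * (13 + time B p) \<le> B * (13 + time B p)"
    using For.prems by (intro mult_right_mono) auto
  with t(1) have "1 + 3 + t \<le> time B (For i x p)" unfolding time.simps by linarith
  ultimately show ?case by blast
qed

lemma time_poly: "\<exists>p. \<forall>B. time B c = poly p B"
proof (induction c)
  case Nop
  show ?case by (intro exI[of _ 1]) simp
next
  case (Assign x i a)
  show ?case by (intro exI[of _ "[:1 + cost i + cost a:]"]) simp
next
  case (Then c1 c2)
  then obtain p q where "\<forall>B. time B c1 = poly p B" "\<forall>B. time B c2 = poly q B" by blast
  then show ?case by (intro exI[of _ "1 + p + q"]) simp
next
  case (Cond b c1 c2)
  then obtain p q where "\<forall>B. time B c1 = poly p B" "\<forall>B. time B c2 = poly q B" by blast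
  then show ?case by (intro exI[of _ "[:1 + cost b:] + p + q"]) simp
next
  case (For i x c)
  then obtain p where "\<forall>B. time B c = poly p B" by blast
  then show ?case by (intro exI[of _ "[:10:] + [:0, 1:] * ([:13:] + p)"]) simp
qed

section \<open>The kernelization program\<close>

text \<open>The rows of the incidence matrix are kept in \<open>a\<close>, the one of edge \<open>e\<close> starting at cell \<open>b e\<close>, because
  there is no multiplication to compute this position. The flags \<open>x v\<close> and \<open>d e\<close> mark killed vertices
  and the edges that contain one.\<close>

definition entry :: "string \<Rightarrow> string \<Rightarrow> exp" where
  "entry e v = Read ''a'' (Plus (Read ''b'' (V e)) (V v))"

text \<open>\<open>write_kernel\<close> overwrites \<open>io\<close> while \<open>greedy\<close>
  still needs the whole matrix, hence the copy. The offset 3 skips \<open>k\<close> and the two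
  counts.\<close>

definition copy_matrix :: loop where
  "copy_matrix = ''r'' :=: Const 0 ;; For ''e'' ''m'' (Assign ''b'' (V ''e'') (V ''r'') ;;
     For ''v'' ''n'' (Assign ''a'' (V ''r'') (Read ''io'' (Plus (Const 3) (V ''r''))) ;;
       ''r'' :=: Plus (V ''r'') (Const 1)))"

definition kill :: loop where
  "kill = Assign ''x'' (V ''w'') (Const 1) ;;
     For ''f'' ''m'' (Cond (entry ''f'' ''w'') (Assign ''d'' (V ''f'') (Const 1)) Nop)"

text \<open>Killed vertices are included in the count: edges meeting one disappear as a whole and
  the others keep their size, so one scan suffices. \<open>Minus (Const 2) (V ''c'')\<close> is
  nonzero exactly if the count is below two.\<close>

definition kill_singletons :: loop where
  "kill_singletons = For ''e'' ''m'' (''c'' :=: Const 0 ;;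
     For ''v'' ''n'' (Cond (entry ''e'' ''v'')
       (''c'' :=: Plus (V ''c'') (Const 1) ;; ''w'' :=: V ''v'') Nop) ;;
     Cond (Minus (Const 2) (V ''c'')) kill Nop)"

definition write_kernel :: loop where
  "write_kernel = ''q'' :=: Const 0 ;;
     For ''v'' ''n'' (Cond (Read ''x'' (V ''v'')) Nop (''q'' :=: Plus (V ''q'') (Const 1))) ;;
     ''y'' :=: Const 0 ;; ''r'' :=: Const 3 ;;
     For ''e'' ''m'' (Cond (Read ''d'' (V ''e'')) Nop (''y'' :=: Plus (V ''y'') (Const 1) ;;
       For ''v'' ''n'' (Cond (Read ''x'' (V ''v'')) Nop
         (Assign ''io'' (V ''r'') (entry ''e'' ''v'') ;; ''r'' :=: Plus (V ''r'') (Const 1))))) ;;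
     Assign ''io'' (Const 1) (V ''q'') ;; Assign ''io'' (Const 2) (V ''y'') ;; ''len'' :=: V ''r''"

text \<open>\<open>g = 0\<close> encodes that no vertex of positive degree has been found yet. The
  sum of truncated differences is nonzero exactly if \<open>c < g\<close> or \<open>g = 0\<close>.
  Subtracting the flag \<open>d e\<close> from the entry restricts the count to live edges.\<close>

definition min_degree :: loop where
  "min_degree = ''g'' :=: Const 0 ;; For ''v'' ''n'' (''c'' :=: Const 0 ;;
     For ''e'' ''m'' (''c'' :=: Plus (V ''c'') (Minus (entry ''e'' ''v'') (Read ''d'' (V ''e'')))) ;;
     Cond (V ''c'') (Cond (Plus (Minus (V ''g'') (V ''c'')) (Minus (Const 1) (V ''g'')))
       (''g'' :=: V ''c'' ;; ''u'' :=: V ''v'') Nop) Nop)"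

text \<open>The sum of the two truncated differences tests \<open>u \<noteq> v\<close>.\<close>

definition pick_other :: loop where
  "pick_other = For ''v'' ''n'' (Cond (entry ''e'' ''v'')
     (Cond (Plus (Minus (V ''u'') (V ''v'')) (Minus (V ''v'') (V ''u''))) (''w'' :=: V ''v'') Nop) Nop)"

text \<open>\<open>kill\<close> updates the flags \<open>d\<close> at once, so an edge already hit
  by an earlier choice is skipped.\<close>

definition kill_neighbours :: loop where
  "kill_neighbours = For ''e'' ''m''
     (Cond (Minus (entry ''e'' ''u'') (Read ''d'' (V ''e''))) (pick_other ;; kill) Nop)"

text \<open>\<open>m\<close> rounds suffice: a round that finds a vertex of positive degree hits at
  least one live edge, and any other round leaves the flags unchanged.\<close>

definition greedy :: loop where
  "greedy = For ''i'' ''m'' (min_degree ;; Cond (V ''g'') kill_neighbours Nop)"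

definition count_alive :: loop where
  "count_alive = ''t'' :=: V ''n'' ;;
     For ''v'' ''n'' (''t'' :=: Minus (V ''t'') (Read ''x'' (V ''v'')))"

lemmas program_defs = copy_matrix_def kill_def kill_singletons_def write_kernel_def min_degree_def
  pick_other_def kill_neighbours_def greedy_def count_alive_def

lemma writes_simps [simp]:
  "writes copy_matrix = {''r'', ''e'', ''b'', ''v'', ''a''}"
  "writes kill = {''x'', ''f'', ''d''}"
  "writes kill_singletons = {''e'', ''c'', ''v'', ''w'', ''x'', ''f'', ''d''}"
  "writes write_kernel = {''q'', ''v'', ''y'', ''r'', ''e'', ''io'', ''len''}"
  "writes min_degree = {''g'', ''v'', ''c'', ''e'', ''u''}"
  "writes pick_other = {''v'', ''w''}"
  "writes kill_neighbours = {''e'', ''v'', ''w'', ''x'', ''f'', ''d''}"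
  "writes greedy = {''i'', ''g'', ''v'', ''c'', ''e'', ''u'', ''w'', ''x'', ''f'', ''d''}"
  "writes count_alive = {''t'', ''v''}"
  by (auto simp: program_defs)

section \<open>Correctness of the individual loops\<close>

lemma run_copy_matrix:
  assumes n: "s ''n'' 0 = n" and m: "s ''m'' 0 = m"
  defines "s' \<equiv> run copy_matrix s"
  shows "e < m \<Longrightarrow> s' ''b'' e = e * n" and "j < m * n \<Longrightarrow> s' ''a'' j = s ''io'' (3 + j)"
proof -
  let ?inner = "Assign ''a'' (V ''r'') (Read ''io'' (Plus (Const 3) (V ''r''))) ;;
       ''r'' :=: Plus (V ''r'') (Const 1)"
  let ?body = "Assign ''b'' (V ''e'') (V ''r'') ;; For ''v'' ''n'' ?inner"
  let ?s = "set0 ''r'' 0 s"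
  define I where "I = (\<lambda>j (s' :: state). s' ''r'' 0 = j * n \<and> (\<forall>e<j. s' ''b'' e = e * n) \<and>
    (\<forall>p<j * n. s' ''a'' p = s ''io'' (3 + p)))"
  have "I (?s ''m'' 0) (run (For ''e'' ''m'' ?body) ?s)"
  proof (rule run_For)
    show "I 0 (set0 ''e'' 0 ?s)" by (simp add: I_def)
  next
    fix j t
    assume j: "j < ?s ''m'' 0" and t: "t ''e'' 0 = j"
      and fr: "\<And>y. y \<notin> insert ''e'' (writes ?body) \<Longrightarrow> t y = ?s y" and I: "I j t"
    let ?t = "t(''b'' := (t ''b'')(j := t ''r'' 0))"
    define K where "K = (\<lambda>i (s' :: state). s' ''r'' 0 = j * n + i \<and>
      (\<forall>p<j * n + i. s' ''a'' p = s ''io'' (3 + p)))"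
    have "K (?t ''n'' 0) (run (For ''v'' ''n'' ?inner) ?t)"
    proof (rule run_For)
      show "K 0 (set0 ''v'' 0 ?t)" using I by (simp add: I_def K_def)
    next
      fix i u
      assume "i < ?t ''n'' 0" "u ''v'' 0 = i" and K: "K i u"
        and fr2: "\<And>y. y \<notin> insert ''v'' (writes ?inner) \<Longrightarrow> u y = ?t y"
      have "u ''io'' = s ''io''" using fr2[of "''io''"] fr[of "''io''"] by simp
      with K show "K (Suc i) (set0 ''v'' (Suc i) (run ?inner u))"
        by (auto simp: K_def less_Suc_eq)
    qed
    moreover have "?t ''n'' 0 = n" using fr[of "''n''"] n by simp
    moreover have "run (For ''v'' ''n'' ?inner) ?t ''b'' = ?t ''b''" by (rule run_frame) simp
    ultimately show "I (Suc j) (set0 ''e'' (Suc j) (run ?body t))"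
      using I t by (simp add: I_def K_def less_Suc_eq add.commute del: run.simps(5))
  qed
  then have I: "I m s'"
    using m by (simp add: s'_def copy_matrix_def del: run.simps(5))
  show "e < m \<Longrightarrow> s' ''b'' e = e * n" "j < m * n \<Longrightarrow> s' ''a'' j = s ''io'' (3 + j)"
    using I by (simp_all add: I_def)
qed

text \<open>Vertices and edges are replaced by their positions, so parallel edges are distinct
  indices with equal \<open>F e\<close>.\<close>

locale incidence =
  fixes n m :: nat and F :: "nat \<Rightarrow> nat set"
  assumes F_subset: "e < m \<Longrightarrow> F e \<subseteq> {..<n}" and F_nonempty: "e < m \<Longrightarrow> F e \<noteq> {}"
begin

text \<open>The layout of \<open>a\<close> and \<open>b\<close> is hidden behind
  \<open>entry\<close>. Once copied, the matrix stays fixed and only the flags described by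
  \<open>killed\<close> change.\<close>

definition represents :: "state \<Rightarrow> bool" where
  "represents s \<longleftrightarrow> s ''n'' 0 = n \<and> s ''m'' 0 = m \<and>
     (\<forall>e<m. \<forall>v<n. val (entry ''e'' ''v'') (set0 ''e'' e (set0 ''v'' v s)) = of_bool (v \<in> F e))"

definition killed :: "nat set \<Rightarrow> state \<Rightarrow> bool" where
  "killed X s \<longleftrightarrow> X \<subseteq> {..<n} \<and> (\<forall>v<n. s ''x'' v = of_bool (v \<in> X)) \<and>
     (\<forall>e<m. s ''d'' e = of_bool (F e \<inter> X \<noteq> {}))"

lemma represents_cong:
  "represents s \<Longrightarrow> s' ''n'' = s ''n'' \<Longrightarrow> s' ''m'' = s ''m'' \<Longrightarrow> s' ''a'' = s ''a'' \<Longrightarrow>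
    s' ''b'' = s ''b'' \<Longrightarrow> represents s'"
  by (simp add: represents_def entry_def)

lemma killed_cong:
  "killed X s \<Longrightarrow> s' ''x'' = s ''x'' \<Longrightarrow> s' ''d'' = s ''d'' \<Longrightarrow> killed X s'"
  by (simp add: killed_def)

lemma represents_run:
  "represents s \<Longrightarrow> {''n'', ''m'', ''a'', ''b''} \<inter> writes p = {} \<Longrightarrow> represents (run p s)"
  by (rule represents_cong[of s]) (auto intro!: run_frame)

lemma killed_run:
  "killed X s \<Longrightarrow> {''x'', ''d''} \<inter> writes p = {} \<Longrightarrow> killed X (run p s)"
  by (rule killed_cong[of _ s]) (auto intro!: run_frame)

lemma val_entry:
  "represents s \<Longrightarrow> s x 0 < m \<Longrightarrow> s y 0 < n \<Longrightarrow> val (entry x y) s = of_bool (s y 0 \<in> F (s x 0))"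
  by (simp add: represents_def entry_def)

lemma run_kill:
  assumes s: "represents s" and X: "killed X s" and w: "s ''w'' 0 = w" "w < n"
  shows "killed (insert w X) (run kill s)"
proof -
  let ?body = "Cond (entry ''f'' ''w'') (Assign ''d'' (V ''f'') (Const 1)) Nop"
  let ?s = "s(''x'' := (s ''x'')(w := 1))"
  \<comment> \<open>During the scan the flags of the first \<open>j\<close> edges already account
    for \<open>w\<close>, the others still describe \<open>X\<close>.\<close>
  define I where "I = (\<lambda>j (s' :: state). \<forall>e<m. s' ''d'' e = of_bool (F e \<inter> (if e < j then insert w X else X) \<noteq> {}))"
  have "I (?s ''m'' 0) (run (For ''f'' ''m'' ?body) ?s)"
  proof (rule run_For)
    show "I 0 (set0 ''f'' 0 ?s)" using X by (simp add: I_def killed_def)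
  next
    fix j t
    assume j: "j < ?s ''m'' 0" and t: "t ''f'' 0 = j" and I: "I j t"
      and fr: "\<And>y. y \<notin> insert ''f'' (writes ?body) \<Longrightarrow> t y = ?s y"
    have "represents t" by (rule represents_cong[OF s]) (simp_all add: fr)
    moreover have "t ''w'' 0 = w" using fr[of "''w''"] w by simp
    moreover have "j < m" using j s by (simp add: represents_def)
    ultimately have "val (entry ''f'' ''w'') t = of_bool (w \<in> F j)"
      using t w by (simp add: val_entry)
    then show "I (Suc j) (set0 ''f'' (Suc j) (run ?body t))"
      using I t by (auto simp: I_def less_Suc_eq)
  qed
  then have "I m (run kill s)"
    using s w by (simp add: kill_def represents_def del: run.simps(5))
  moreover have "run kill s ''x'' = (s ''x'')(w := 1)"
    using w by (simp add: kill_def run_frame fun_upd_def del: run.simps(5))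
  ultimately show ?thesis using X w by (auto simp: killed_def I_def)
qed

lemma run_kill_singletons:
  assumes s: "represents s" and X: "killed {} s"
  obtains Z where "killed Z (run kill_singletons s)"
    and "\<And>z. z \<in> Z \<Longrightarrow> \<exists>e<m. F e = {z}"
    and "\<And>e. e < m \<Longrightarrow> F e \<inter> Z = {} \<Longrightarrow> card (F e) \<ge> 2"
proof -
  let ?inner = "Cond (entry ''e'' ''v'')
       (''c'' :=: Plus (V ''c'') (Const 1) ;; ''w'' :=: V ''v'') Nop"
  let ?body = "''c'' :=: Const 0 ;; For ''v'' ''n'' ?inner ;; Cond (Minus (Const 2) (V ''c'')) kill Nop"
  \<comment> \<open>The last clause persists when \<open>Z\<close> grows, since fewer edges then
    avoid \<open>Z\<close>.\<close>
  define I where "I = (\<lambda>j (s' :: state). \<exists>Z. killed Z s' \<and> (\<forall>z \<in> Z. \<exists>e<m. F e = {z}) \<and>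
    (\<forall>e<j. F e \<inter> Z = {} \<longrightarrow> card (F e) \<ge> 2))"
  have "I (s ''m'' 0) (run (For ''e'' ''m'' ?body) s)"
  proof (rule run_For)
    show "I 0 (set0 ''e'' 0 s)" using killed_cong[OF X, of "set0 ''e'' 0 s"] by (auto simp: I_def intro!: exI[of _ "{}"])
  next
    fix j t
    assume j: "j < s ''m'' 0" and t: "t ''e'' 0 = j" and I: "I j t"
      and fr: "\<And>y. y \<notin> insert ''e'' (writes ?body) \<Longrightarrow> t y = s y"
    have jm: "j < m" using j s by (simp add: represents_def)
    have t': "represents t" by (rule represents_cong[OF s]) (simp_all add: fr)
    let ?t = "set0 ''c'' 0 t"
    \<comment> \<open>\<open>w\<close> holds the last vertex of the edge seen so far, which is its
      only vertex if the count ends at 1.\<close>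
    define K where "K = (\<lambda>i (s' :: state). s' ''c'' 0 = card (F j \<inter> {..<i}) \<and> (F j \<inter> {..<i} \<noteq> {} \<longrightarrow> s' ''w'' 0 \<in> F j))"
    define t1 where "t1 = run (For ''v'' ''n'' ?inner) ?t"
    have "K (?t ''n'' 0) t1"
      unfolding t1_def
    proof (rule run_For)
      show "K 0 (set0 ''v'' 0 ?t)" by (simp add: K_def)
    next
      fix i u
      assume i: "i < ?t ''n'' 0" and u: "u ''v'' 0 = i" and K: "K i u"
        and fr2: "\<And>y. y \<notin> insert ''v'' (writes ?inner) \<Longrightarrow> u y = ?t y"
      have "represents u" by (rule represents_cong[OF t']) (simp_all add: fr2)
      moreover have "i < n" using i t' by (simp add: represents_def)
      ultimately have e: "val (entry ''e'' ''v'') u = of_bool (i \<in> F j)"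
        using val_entry[of u "''e''" "''v''"] fr2[of "''e''"] t u jm by simp
      have "F j \<inter> {..<Suc i} = (if i \<in> F j then insert i (F j \<inter> {..<i}) else F j \<inter> {..<i})"
        by (auto simp: less_Suc_eq)
      with K e u show "K (Suc i) (set0 ''v'' (Suc i) (run ?inner u))"
        by (auto simp: K_def)
    qed
    moreover have "?t ''n'' 0 = n" using t' by (simp add: represents_def)
    moreover have "F j \<inter> {..<n} = F j" using F_subset[OF jm] by auto
    ultimately have K: "t1 ''c'' 0 = card (F j)" "t1 ''w'' 0 \<in> F j"
      using F_nonempty[OF jm] by (simp_all add: K_def)
    have t1: "represents t1"
      unfolding t1_def by (intro represents_run represents_cong[OF t']) simp_all
    from I obtain Z where Z: "killed Z t" "\<forall>z \<in> Z. \<exists>e<m. F e = {z}"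
      "\<forall>e<j. F e \<inter> Z = {} \<longrightarrow> card (F e) \<ge> 2" by (auto simp: I_def)
    have Z1: "killed Z t1"
      unfolding t1_def by (intro killed_run killed_cong[OF Z(1)]) simp_all
    have r: "run ?body t = (if card (F j) < 2 then run kill t1 else t1)"
      using K(1) by (simp add: t1_def del: run.simps(5))
    show "I (Suc j) (set0 ''e'' (Suc j) (run ?body t))"
    proof (cases "card (F j) < 2")
      case True
      have fin: "finite (F j)" using F_subset[OF jm] finite_subset by blast
      with F_nonempty[OF jm] have "card (F j) > 0" by (simp add: card_gt_0_iff)
      with True have "card (F j) = 1" by simp
      with K(2) have Fj: "F j = {t1 ''w'' 0}" by (auto simp: card_1_singleton_iff)
      let ?Z = "insert (t1 ''w'' 0) Z"
      have "killed ?Z (run kill t1)"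
        using run_kill[OF t1 Z1 refl] K(2) F_subset[OF jm] by auto
      then have "killed ?Z (set0 ''e'' (Suc j) (run kill t1))" by (rule killed_cong) simp_all
      then show ?thesis unfolding r I_def using True Z Fj jm
        by (intro exI[of _ ?Z]) (auto simp: less_Suc_eq)
    next
      case False
      have "killed Z (set0 ''e'' (Suc j) t1)" by (rule killed_cong[OF Z1]) simp_all
      then show ?thesis unfolding r I_def using False Z
        by (intro exI[of _ Z]) (auto simp: less_Suc_eq)
    qed
  qed
  then have "I m (run kill_singletons s)"
    using s unfolding kill_singletons_def by (simp add: represents_def del: run.simps)
  then show ?thesis using that by (auto simp: I_def)
qed


lemma run_write_kernel:
  assumes s: "represents s" and Z: "killed Z s"
  defines "vs \<equiv> filter (\<lambda>v. v \<notin> Z) [0..<n]" and "es \<equiv> filter (\<lambda>e. F e \<inter> Z = {}) [0..<m]"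
    and "s' \<equiv> run write_kernel s"
  shows "s' ''q'' 0 = length vs"
    and "output_of s' = [s ''io'' 0, length vs, length es] @
      concat (map (\<lambda>e. map (\<lambda>v. of_bool (v \<in> F e)) vs) es)"
proof -
  let ?count = "Cond (Read ''x'' (V ''v'')) Nop (''q'' :=: Plus (V ''q'') (Const 1))"
  let ?inner = "Cond (Read ''x'' (V ''v'')) Nop
    (Assign ''io'' (V ''r'') (entry ''e'' ''v'') ;; ''r'' :=: Plus (V ''r'') (Const 1))"
  let ?body = "Cond (Read ''d'' (V ''e'')) Nop
    (''y'' :=: Plus (V ''y'') (Const 1) ;; For ''v'' ''n'' ?inner)"
  define s1 where "s1 = run (For ''v'' ''n'' ?count) (set0 ''q'' 0 s)"
  define J where "J = (\<lambda>j (s' :: state). s' ''q'' 0 = length (filter (\<lambda>v. v \<notin> Z) [0..<j]))"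
  have "J (set0 ''q'' 0 s ''n'' 0) s1"
    unfolding s1_def
  proof (rule run_For)
    show "J 0 (set0 ''v'' 0 (set0 ''q'' 0 s))" by (simp add: J_def)
  next
    fix j t
    assume j: "j < set0 ''q'' 0 s ''n'' 0" and t: "t ''v'' 0 = j" and J: "J j t"
      and fr: "\<And>y. y \<notin> insert ''v'' (writes ?count) \<Longrightarrow> t y = set0 ''q'' 0 s y"
    have "killed Z t" by (rule killed_cong[OF Z]) (simp_all add: fr)
    moreover have "j < n" using j s by (simp add: represents_def)
    ultimately have "t ''x'' j = of_bool (j \<in> Z)" by (simp add: killed_def)
    then show "J (Suc j) (set0 ''v'' (Suc j) (run ?count t))"
      using J t by (simp add: J_def)
  qed
  then have q: "s1 ''q'' 0 = length vs"
    using s by (simp add: J_def vs_def represents_def)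
  have s1: "represents s1" "killed Z s1"
    unfolding s1_def
    by (intro represents_run represents_cong[OF s] killed_run killed_cong[OF Z]; simp)+
  have s1_io: "s1 ''io'' = s ''io''"
    unfolding s1_def by (simp add: run_frame del: run.simps)
  let ?s2 = "set0 ''r'' 3 (set0 ''y'' 0 s1)"
  let ?row = "\<lambda>vs e. map (\<lambda>v. of_bool (v \<in> F e)) vs :: nat list"
  \<comment> \<open>The header cells 1 and 2 are filled only after both counts are known, so the
    rows are tracked from cell 3 on.\<close>
  define I where "I = (\<lambda>j (s' :: state). 3 \<le> s' ''r'' 0 \<and> s' ''io'' 0 = s ''io'' 0 \<and>
    s' ''y'' 0 = length (filter (\<lambda>e. F e \<inter> Z = {}) [0..<j]) \<and>
    map (s' ''io'') [3..<s' ''r'' 0] = concat (map (?row vs) (filter (\<lambda>e. F e \<inter> Z = {}) [0..<j])))"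
  define s3 where "s3 = run (For ''e'' ''m'' ?body) ?s2"
  have "I (?s2 ''m'' 0) s3"
    unfolding s3_def
  proof (rule run_For)
    show "I 0 (set0 ''e'' 0 ?s2)" by (simp add: I_def s1_io)
  next
    fix j t
    assume j: "j < ?s2 ''m'' 0" and t: "t ''e'' 0 = j" and I: "I j t"
      and fr: "\<And>y. y \<notin> insert ''e'' (writes ?body) \<Longrightarrow> t y = ?s2 y"
    have jm: "j < m" using j s1(1) by (simp add: represents_def)
    have t1: "represents t" by (rule represents_cong[OF s1(1)]) (simp_all add: fr)
    have t2: "killed Z t" by (rule killed_cong[OF s1(2)]) (simp_all add: fr)
    have d: "t ''d'' j = of_bool (F j \<inter> Z \<noteq> {})" using t2 jm by (simp add: killed_def)
    show "I (Suc j) (set0 ''e'' (Suc j) (run ?body t))"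
    proof (cases "F j \<inter> Z = {}")
      case False
      with d t I show ?thesis by (simp add: I_def)
    next
      case True
      let ?t = "set0 ''y'' (Suc (t ''y'' 0)) t"
      define t' where "t' = run (For ''v'' ''n'' ?inner) ?t"
      define K where "K = (\<lambda>i (s' :: state). 3 \<le> s' ''r'' 0 \<and> s' ''io'' 0 = s ''io'' 0 \<and>
        map (s' ''io'') [3..<s' ''r'' 0] =
        map (t ''io'') [3..<t ''r'' 0] @ ?row (filter (\<lambda>v. v \<notin> Z) [0..<i]) j)"
      have "K (?t ''n'' 0) t'"
        unfolding t'_def
      proof (rule run_For)
        show "K 0 (set0 ''v'' 0 ?t)" using I by (simp add: K_def I_def)
      next
        fix i u
        assume i: "i < ?t ''n'' 0" and u: "u ''v'' 0 = i" and K: "K i u"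
          and fr2: "\<And>y. y \<notin> insert ''v'' (writes ?inner) \<Longrightarrow> u y = ?t y"
        have u1: "represents u" by (rule represents_cong[OF t1]) (simp_all add: fr2)
        have u2: "killed Z u" by (rule killed_cong[OF t2]) (simp_all add: fr2)
        have i: "i < n" using i t1 by (simp add: represents_def)
        have x: "u ''x'' i = of_bool (i \<in> Z)" using u2 i by (simp add: killed_def)
        have e: "val (entry ''e'' ''v'') u = of_bool (i \<in> F j)"
          using val_entry[of u "''e''" "''v''"] u1 fr2[of "''e''"] t u jm i by simp
        show "K (Suc i) (set0 ''v'' (Suc i) (run ?inner u))"
          using K x e u by (simp add: K_def)
      qed
      then have K: "K n t'" using t1 by (simp add: represents_def)
      have "t' ''y'' 0 = Suc (t ''y'' 0)" unfolding t'_def by (simp add: run_frame del: run.simps)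
      moreover have "run ?body t = t'" using d True t by (simp add: t'_def del: run.simps(5))
      ultimately show ?thesis using K I True by (simp add: I_def K_def vs_def)
    qed
  qed
  then have I: "I m s3" using s1(1) by (simp add: represents_def)
  have q3: "s3 ''q'' 0 = length vs" unfolding s3_def using q by (simp add: run_frame del: run.simps)
  have s': "s' = set0 ''len'' (s3 ''r'' 0)
      (s3(''io'' := (s3 ''io'')(1 := s3 ''q'' 0, 2 := s3 ''y'' 0)))"
    unfolding s'_def write_kernel_def s3_def s1_def by (simp del: run.simps(5))
  show "s' ''q'' 0 = length vs" using q3 by (simp add: s')
  have split: "[0..<r] = [0, 1, 2] @ [3..<r]" if "3 \<le> r" for r
    using upt_add_eq_append[of 0 3 "r - 3"] that by (simp add: upt_rec)
  show "output_of s' = [s ''io'' 0, length vs, length es] @ concat (map (?row vs) es)"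
    using I q3 split[of "s3 ''r'' 0"] by (simp add: s' output_of_def I_def es_def)
qed

definition live_degree :: "nat set \<Rightarrow> nat \<Rightarrow> nat" where
  "live_degree X v = card {e. e < m \<and> F e \<inter> X = {} \<and> v \<in> F e}"

lemma run_min_degree:
  assumes s: "represents s" and X: "killed X s"
  defines "s' \<equiv> run min_degree s"
  shows "v < n \<Longrightarrow> 0 < live_degree X v \<Longrightarrow> 0 < s' ''g'' 0 \<and> s' ''g'' 0 \<le> live_degree X v"
    and "0 < s' ''g'' 0 \<Longrightarrow> s' ''u'' 0 < n \<and> live_degree X (s' ''u'' 0) = s' ''g'' 0"
proof -
  let ?inner = "''c'' :=: Plus (V ''c'') (Minus (entry ''e'' ''v'') (Read ''d'' (V ''e'')))"
  let ?test = "Cond (V ''c'') (Cond (Plus (Minus (V ''g'') (V ''c'')) (Minus (Const 1) (V ''g'')))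
       (''g'' :=: V ''c'' ;; ''u'' :=: V ''v'') Nop) Nop"
  let ?body = "''c'' :=: Const 0 ;; For ''e'' ''m'' ?inner ;; ?test"
  let ?s = "set0 ''g'' 0 s"
  define I where "I = (\<lambda>j (s' :: state).
    (\<forall>v<j. 0 < live_degree X v \<longrightarrow> 0 < s' ''g'' 0 \<and> s' ''g'' 0 \<le> live_degree X v) \<and>
    (0 < s' ''g'' 0 \<longrightarrow> s' ''u'' 0 < j \<and> live_degree X (s' ''u'' 0) = s' ''g'' 0))"
  have "I (?s ''n'' 0) (run (For ''v'' ''n'' ?body) ?s)"
  proof (rule run_For)
    show "I 0 (set0 ''v'' 0 ?s)" by (simp add: I_def)
  next
    fix j t
    assume j: "j < ?s ''n'' 0" and t: "t ''v'' 0 = j" and I: "I j t"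
      and fr: "\<And>y. y \<notin> insert ''v'' (writes ?body) \<Longrightarrow> t y = ?s y"
    have jn: "j < n" using j s by (simp add: represents_def)
    have t1: "represents t" by (rule represents_cong[OF s]) (simp_all add: fr)
    have t2: "killed X t" by (rule killed_cong[OF X]) (simp_all add: fr)
    define t' where "t' = run (For ''e'' ''m'' ?inner) (set0 ''c'' 0 t)"
    define K where "K = (\<lambda>i (s' :: state).
      s' ''c'' 0 = card {e. e < i \<and> F e \<inter> X = {} \<and> j \<in> F e})"
    have "K (set0 ''c'' 0 t ''m'' 0) t'"
      unfolding t'_def
    proof (rule run_For)
      show "K 0 (set0 ''e'' 0 (set0 ''c'' 0 t))" by (simp add: K_def)
    next
      fix i u
      assume i: "i < set0 ''c'' 0 t ''m'' 0" and u: "u ''e'' 0 = i" and K: "K i u"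
        and fr2: "\<And>y. y \<notin> insert ''e'' (writes ?inner) \<Longrightarrow> u y = set0 ''c'' 0 t y"
      have u1: "represents u" by (rule represents_cong[OF t1]) (simp_all add: fr2)
      have u2: "killed X u" by (rule killed_cong[OF t2]) (simp_all add: fr2)
      have i: "i < m" using i t1 by (simp add: represents_def)
      have d: "u ''d'' i = of_bool (F i \<inter> X \<noteq> {})" using u2 i by (simp add: killed_def)
      have e: "val (entry ''e'' ''v'') u = of_bool (j \<in> F i)"
        using val_entry[of u "''e''" "''v''"] u1 fr2[of "''v''"] t u jn i by simp
      have "{e. e < Suc i \<and> F e \<inter> X = {} \<and> j \<in> F e} =
          (if F i \<inter> X = {} \<and> j \<in> F i then insert i {e. e < i \<and> F e \<inter> X = {} \<and> j \<in> F e}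
           else {e. e < i \<and> F e \<inter> X = {} \<and> j \<in> F e})"
        by (auto simp: less_Suc_eq)
      with K d e u show "K (Suc i) (set0 ''e'' (Suc i) (run ?inner u))"
        by (auto simp: K_def)
    qed
    then have c: "t' ''c'' 0 = live_degree X j" using t1 by (simp add: represents_def K_def live_degree_def)
    have fr3: "t' ''g'' = t ''g''" "t' ''u'' = t ''u''" "t' ''v'' = t ''v''"
      unfolding t'_def by (simp_all add: run_frame del: run.simps)
    have "run ?body t = run ?test t'" by (simp add: t'_def del: run.simps(5))
    then show "I (Suc j) (set0 ''v'' (Suc j) (run ?body t))"
      using I c t by (auto simp: I_def fr3 less_Suc_eq)
  qed
  then have "I n s'"
    using s unfolding s'_def min_degree_def by (simp add: represents_def del: run.simps(5))
  then show "v < n \<Longrightarrow> 0 < live_degree X v \<Longrightarrow> 0 < s' ''g'' 0 \<and> s' ''g'' 0 \<le> live_degree X v"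
    and "0 < s' ''g'' 0 \<Longrightarrow> s' ''u'' 0 < n \<and> live_degree X (s' ''u'' 0) = s' ''g'' 0"
    by (simp_all add: I_def)
qed

lemma run_pick_other:
  assumes s: "represents s" and e: "s ''e'' 0 = e" "e < m" and u: "s ''u'' 0 = u" and v: "v \<in> F e" "v \<noteq> u"
  shows "run pick_other s ''w'' 0 \<in> F e - {u}"
proof -
  let ?body = "Cond (entry ''e'' ''v'')
     (Cond (Plus (Minus (V ''u'') (V ''v'')) (Minus (V ''v'') (V ''u''))) (''w'' :=: V ''v'') Nop) Nop"
  \<comment> \<open>\<open>v\<close> only witnesses that the scan meets a candidate; the vertex
    finally in \<open>w\<close> is the last one met and may differ from \<open>v\<close>.\<close>
  define I where "I = (\<lambda>j (s' :: state). v < j \<longrightarrow> s' ''w'' 0 \<in> F e - {u})"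
  have "I (s ''n'' 0) (run (For ''v'' ''n'' ?body) s)"
  proof (rule run_For)
    show "I 0 (set0 ''v'' 0 s)" by (simp add: I_def)
  next
    fix j t
    assume j: "j < s ''n'' 0" and t: "t ''v'' 0 = j" and I: "I j t"
      and fr: "\<And>y. y \<notin> insert ''v'' (writes ?body) \<Longrightarrow> t y = s y"
    have "represents t" by (rule represents_cong[OF s]) (simp_all add: fr)
    moreover have "j < n" using j s by (simp add: represents_def)
    ultimately have "val (entry ''e'' ''v'') t = of_bool (j \<in> F e)"
      using t val_entry[of t "''e''" "''v''"] fr[of "''e''"] e by simp
    moreover have "t ''u'' 0 = u" using fr[of "''u''"] u by simp
    ultimately show "I (Suc j) (set0 ''v'' (Suc j) (run ?body t))"
      using I t v by (auto simp: I_def less_Suc_eq)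
  qed
  moreover have "v < n" using v F_subset[OF e(2)] by auto
  ultimately show ?thesis using s by (simp add: pick_other_def represents_def I_def del: run.simps)
qed

text \<open>Each live edge at \<open>u\<close> not hit by an earlier choice costs one new vertex, so
  the degree of \<open>u\<close> bounds the cost. Hypothesis \<open>two\<close> supplies a vertex
  other than \<open>u\<close>, which keeps \<open>u\<close> alive.\<close>

lemma run_kill_neighbours:
  assumes s: "represents s" and X: "killed X s" and u: "s ''u'' 0 = u" "u < n" "u \<notin> X"
    and two: "\<And>e. e < m \<Longrightarrow> F e \<inter> X = {} \<Longrightarrow> card (F e) \<ge> 2"
  obtains Y where "killed Y (run kill_neighbours s)" "X \<subseteq> Y" "u \<notin> Y"
    "\<And>v. v \<in> Y - X \<Longrightarrow> \<exists>e<m. F e \<inter> X = {} \<and> v \<in> F e"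
    "card (Y - X) \<le> live_degree X u" "\<And>e. e < m \<Longrightarrow> u \<in> F e \<Longrightarrow> F e \<inter> Y \<noteq> {}"
proof -
  let ?body = "Cond (Minus (entry ''e'' ''u'') (Read ''d'' (V ''e''))) (pick_other ;; kill) Nop"
  define P where "P = (\<lambda>j Y. X \<subseteq> Y \<and> u \<notin> Y \<and> (\<forall>v \<in> Y - X. \<exists>e<m. F e \<inter> X = {} \<and> v \<in> F e) \<and>
    card (Y - X) \<le> card {e. e < j \<and> F e \<inter> X = {} \<and> u \<in> F e} \<and>
    (\<forall>e<j. u \<in> F e \<longrightarrow> F e \<inter> Y \<noteq> {}))"
  define I where "I = (\<lambda>j (s' :: state). \<exists>Y. killed Y s' \<and> P j Y)"
  have "I (s ''m'' 0) (run (For ''e'' ''m'' ?body) s)"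
  proof (rule run_For)
    have "killed X (set0 ''e'' 0 s)" by (rule killed_cong[OF X]) simp_all
    then show "I 0 (set0 ''e'' 0 s)" using u by (auto simp: I_def P_def intro!: exI[of _ X])
  next
    fix j t
    assume j: "j < s ''m'' 0" and t: "t ''e'' 0 = j" and I: "I j t"
      and fr: "\<And>y. y \<notin> insert ''e'' (writes ?body) \<Longrightarrow> t y = s y"
    have jm: "j < m" using j s by (simp add: represents_def)
    have t1: "represents t" by (rule represents_cong[OF s]) (simp_all add: fr)
    obtain Y where Y: "killed Y t" "P j Y" using I by (auto simp: I_def)
    have tu: "t ''u'' 0 = u" using fr[of "''u''"] u by simp
    have d: "t ''d'' j = of_bool (F j \<inter> Y \<noteq> {})" using Y(1) jm by (simp add: killed_def)
    have e: "val (entry ''e'' ''u'') t = of_bool (u \<in> F j)"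
      using val_entry[of t "''e''" "''u''"] t1 t tu jm u by simp
    have fin: "finite {e. e < k \<and> F e \<inter> X = {} \<and> u \<in> F e}" for k by simp
    show "I (Suc j) (set0 ''e'' (Suc j) (run ?body t))"
    proof (cases "F j \<inter> Y = {} \<and> u \<in> F j")
      case False
      then have r: "run ?body t = t" using d e t by auto
      have "killed Y (set0 ''e'' (Suc j) t)" by (rule killed_cong[OF Y(1)]) simp_all
      moreover have "P (Suc j) Y"
        using Y(2) False card_mono[OF fin[of "Suc j"], of "{e. e < j \<and> F e \<inter> X = {} \<and> u \<in> F e}"]
        by (fastforce simp: P_def less_Suc_eq)
      ultimately show ?thesis unfolding r by (auto simp: I_def)
    next
      case True
      define t' where "t' = run pick_other t"
      define w where "w = t' ''w'' 0"
      have r: "run ?body t = run kill t'" using d e t True by (simp add: t'_def)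
      \<comment> \<open>\<open>Y\<close> contains \<open>X\<close>, so an edge missing
        \<open>Y\<close> is live for \<open>X\<close> as well and is counted in the degree of
        \<open>u\<close>.\<close>
      have live: "F j \<inter> X = {}" using Y(2) True by (auto simp: P_def)
      have "\<not> F j \<subseteq> {u}"
        using two[OF jm live] card_mono[of "{u}" "F j"] by auto
      then obtain v where "v \<in> F j" "v \<noteq> u" by auto
      from run_pick_other[OF t1 t jm tu this] have w: "w \<in> F j" "w \<noteq> u"
        by (auto simp: w_def t'_def)
      have "represents t'" "killed Y t'"
        unfolding t'_def by (intro represents_run killed_run t1 Y; simp)+
      then have "killed (insert w Y) (run kill t')"
        using w F_subset[OF jm] by (intro run_kill) (auto simp: w_def)
      then have "killed (insert w Y) (set0 ''e'' (Suc j) (run kill t'))"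
        by (rule killed_cong) simp_all
      moreover have "P (Suc j) (insert w Y)"
      proof -
        have "{e. e < Suc j \<and> F e \<inter> X = {} \<and> u \<in> F e} =
            insert j {e. e < j \<and> F e \<inter> X = {} \<and> u \<in> F e}"
          using live True by (auto simp: less_Suc_eq)
        then have "card {e. e < Suc j \<and> F e \<inter> X = {} \<and> u \<in> F e} =
            Suc (card {e. e < j \<and> F e \<inter> X = {} \<and> u \<in> F e})" by simp
        moreover have "card (insert w Y - X) \<le> Suc (card (Y - X))"
        proof -
          have "card (insert w Y - X) \<le> card (insert w (Y - X))"
            using Y(1) by (intro card_mono) (auto simp: killed_def intro: finite_subset)
          also have "\<dots> \<le> Suc (card (Y - X))" by (rule card_insert_le_m1) simp_all
          finally show ?thesis .
        qed
        ultimately show ?thesis using Y(2) w live jm by (auto simp: P_def less_Suc_eq)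
      qed
      ultimately show ?thesis unfolding r by (auto simp: I_def)
    qed
  qed
  then have "I m (run kill_neighbours s)"
    using s unfolding kill_neighbours_def by (simp add: represents_def del: run.simps)
  then obtain Y where "killed Y (run kill_neighbours s)" "P m Y" by (auto simp: I_def)
  with that[of Y] show ?thesis by (auto simp: P_def live_degree_def)
qed

lemma run_count_alive:
  assumes s: "represents s" and X: "killed X s"
  shows "run count_alive s ''t'' 0 = n - card X"
proof -
  let ?body = "''t'' :=: Minus (V ''t'') (Read ''x'' (V ''v''))"
  let ?s = "set0 ''t'' (s ''n'' 0) s"
  define I where "I = (\<lambda>j (s' :: state). s' ''t'' 0 = n - card (X \<inter> {..<j}))"
  have "I (?s ''n'' 0) (run (For ''v'' ''n'' ?body) ?s)"
  proof (rule run_For)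
    show "I 0 (set0 ''v'' 0 ?s)" using s by (simp add: I_def represents_def)
  next
    fix j t
    assume j: "j < ?s ''n'' 0" and t: "t ''v'' 0 = j" and I: "I j t"
      and fr: "\<And>y. y \<notin> insert ''v'' (writes ?body) \<Longrightarrow> t y = ?s y"
    have "killed X t" by (rule killed_cong[OF X]) (simp_all add: fr)
    moreover have "j < n" using j s by (simp add: represents_def)
    ultimately have "t ''x'' j = of_bool (j \<in> X)" by (simp add: killed_def)
    moreover have "X \<inter> {..<Suc j} = (if j \<in> X then insert j (X \<inter> {..<j}) else X \<inter> {..<j})"
      by (auto simp: less_Suc_eq)
    ultimately show "I (Suc j) (set0 ''v'' (Suc j) (run ?body t))"
      using I t by (auto simp: I_def)
  qed
  moreover have "X \<inter> {..<n} = X" using X by (auto simp: killed_def)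
  ultimately show ?thesis using s by (simp add: count_alive_def represents_def I_def del: run.simps(5))
qed

end

section \<open>Degrees and the greedy hitting set\<close>

context incidence begin

definition live :: "nat set \<Rightarrow> nat set" where
  "live X = {e. e < m \<and> F e \<inter> X = {}}"

text \<open>Alive but isolated vertices; their number is the potential in the analysis of
  \<open>greedy\<close>.\<close>

definition free :: "nat set \<Rightarrow> nat set" where
  "free X = {v. v < n \<and> v \<notin> X \<and> (\<forall>e \<in> live X. v \<notin> F e)}"

text \<open>Index form of \<open>degenerate\<close>. The degree is positive because
  \<open>\<ominus>\<close> deletes isolated vertices.\<close>

definition low_degree :: "nat \<Rightarrow> bool" where
  "low_degree d \<longleftrightarrow> (\<forall>X \<subseteq> {..<n}. live X \<noteq> {} \<longrightarrow> (\<exists>v<n. 0 < live_degree X v \<and> live_degree X v \<le> d))"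

lemma finite_live [simp]: "finite (live X)"
  by (simp add: live_def)

lemma finite_free [simp]: "finite (free X)"
  by (simp add: free_def)

lemma live_degree_eq: "live_degree X v = card {e \<in> live X. v \<in> F e}"
  by (simp add: live_degree_def live_def conj_assoc)

lemma live_degree_pos_iff: "0 < live_degree X v \<longleftrightarrow> (\<exists>e \<in> live X. v \<in> F e)"
  by (auto simp: live_degree_eq card_gt_0_iff)

lemma live_degree_pos_notin: "0 < live_degree X v \<Longrightarrow> v \<notin> X"
  by (auto simp: live_degree_pos_iff live_def)

text \<open>Killing a vertex of positive degree at most \<open>d\<close> removes one alive vertex
  and at most \<open>d\<close> live edges. Applied to the deleted set \<open>Z\<close>, this bounds
  the edges of the kernel by \<open>d\<close> times its vertices.\<close>

lemma card_live_le:
  assumes "low_degree d" "X \<subseteq> {..<n}"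
  shows "card (live X) \<le> d * (n - card X)"
  using assms(2)
proof (induction "n - card X" arbitrary: X rule: less_induct)
  case (less X)
  show ?case
  proof (cases "live X = {}")
    case False
    then obtain v where v: "v < n" "0 < live_degree X v" "live_degree X v \<le> d"
      using assms(1) less.prems by (auto simp: low_degree_def)
    have vX: "v \<notin> X" by (rule live_degree_pos_notin[OF v(2)])
    have sub: "insert v X \<subseteq> {..<n}" using v less.prems by auto
    have fin: "finite X" using less.prems finite_subset by blast
    have "card (insert v X) \<le> n" using card_mono[OF _ sub] by simp
    then have lt: "Suc (card X) \<le> n" using vX fin by simp
    have "card (live (insert v X)) \<le> d * (n - Suc (card X))"
      using less.hyps[of "insert v X"] sub lt vX fin by simp
    moreover have "live X = live (insert v X) \<union> {e \<in> live X. v \<in> F e}"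
      by (auto simp: live_def)
    then have "card (live X) \<le> card (live (insert v X)) + live_degree X v"
      using card_Un_le[of "live (insert v X)" "{e \<in> live X. v \<in> F e}"] by (simp add: live_degree_eq)
    moreover have "n - card X = Suc (n - Suc (card X))" using lt by simp
    then have "d * (n - card X) = d * (n - Suc (card X)) + d" by simp
    ultimately show ?thesis using v(3) by simp
  qed simp
qed

text \<open>Each round kills at most \<open>d\<close> vertices and frees at least one vertex for good, namely the
  chosen vertex of minimum degree; vertices that are free stay alive, because only vertices of live
  edges are killed.\<close>

lemma run_greedy:
  assumes s: "represents s" and Z: "killed Z s" and low: "low_degree d"
    and two: "\<And>e. e < m \<Longrightarrow> F e \<inter> Z = {} \<Longrightarrow> card (F e) \<ge> 2"
  obtains X where "killed X (run greedy s)" "Z \<subseteq> X" "live X = {}" "card (X - Z) \<le> d * (n - card X)"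
proof -
  let ?body = "min_degree ;; Cond (V ''g'') kill_neighbours Nop"
  \<comment> \<open>Free vertices pay for the killed ones, and the bound on live edges leaves none
    after \<open>m\<close> rounds.\<close>
  define P where "P = (\<lambda>j X. Z \<subseteq> X \<and> card (X - Z) \<le> d * card (free X) \<and> card (live X) \<le> m - j)"
  define I where "I = (\<lambda>j (s' :: state). \<exists>X. killed X s' \<and> P j X)"
  have "I (s ''m'' 0) (run (For ''i'' ''m'' ?body) s)"
  proof (rule run_For)
    have "killed Z (set0 ''i'' 0 s)" by (rule killed_cong[OF Z]) simp_all
    moreover have "card (live Z) \<le> card {..<m}" by (rule card_mono) (auto simp: live_def)
    ultimately show "I 0 (set0 ''i'' 0 s)" by (auto simp: I_def P_def intro!: exI[of _ Z])
  next
    fix j t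
    assume j: "j < s ''m'' 0" and t: "t ''i'' 0 = j" and I: "I j t"
      and fr: "\<And>y. y \<notin> insert ''i'' (writes ?body) \<Longrightarrow> t y = s y"
    obtain X where X: "killed X t" "P j X" using I by (auto simp: I_def)
    have Xn: "X \<subseteq> {..<n}" using X(1) by (simp add: killed_def)
    have t1: "represents t" by (rule represents_cong[OF s]) (simp_all add: fr)
    define t' where "t' = run min_degree t"
    have t': "represents t'" "killed X t'"
      unfolding t'_def by (intro represents_run killed_run t1 X; simp)+
    note md = run_min_degree[OF t1 X(1), folded t'_def]
    show "I (Suc j) (set0 ''i'' (Suc j) (run ?body t))"
    proof (cases "t' ''g'' 0 = 0")
      case True
      then have "live X = {}" using md(1) low Xn by (auto simp: low_degree_def)
      then have "P (Suc j) X" using X(2) by (simp add: P_def)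
      moreover have "killed X (set0 ''i'' (Suc j) t')" by (rule killed_cong[OF t'(2)]) simp_all
      moreover have "run ?body t = t'" using True by (simp add: t'_def)
      ultimately show ?thesis by (auto simp: I_def)
    next
      case False
      define u where "u = t' ''u'' 0"
      have u: "u < n" "live_degree X u = t' ''g'' 0" using md(2) False by (auto simp: u_def)
      have pos: "0 < live_degree X u" using u False by simp
      then obtain e where e: "e \<in> live X" "u \<in> F e" by (auto simp: live_degree_pos_iff)
      then obtain v where v: "v < n" "0 < live_degree X v" "live_degree X v \<le> d"
        using low Xn by (auto simp: low_degree_def)
      \<comment> \<open>\<open>u\<close> has minimum positive degree, so the vertex \<open>v\<close>
        promised by \<open>low_degree\<close> bounds its degree.\<close>
      have ud: "live_degree X u \<le> d" using md(1)[OF v(1,2)] v(3) u(2) by simp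
      have uX: "u \<notin> X" by (rule live_degree_pos_notin[OF pos])
      have "Z \<subseteq> X" using X(2) by (simp add: P_def)
      then have "card (F e) \<ge> 2" if "e < m" "F e \<inter> X = {}" for e using two that by blast
      from run_kill_neighbours[OF t' u_def[symmetric] u(1) uX this]
      obtain Y where Y: "killed Y (run kill_neighbours t')" "X \<subseteq> Y" "u \<notin> Y"
        "\<And>v. v \<in> Y - X \<Longrightarrow> \<exists>e<m. F e \<inter> X = {} \<and> v \<in> F e"
        "card (Y - X) \<le> live_degree X u" "\<And>e. e < m \<Longrightarrow> u \<in> F e \<Longrightarrow> F e \<inter> Y \<noteq> {}"
        by blast
      have liveY: "live Y \<subseteq> live X" "e \<notin> live Y" using Y(2,6) e by (auto simp: live_def)
      then have "live Y \<subset> live X" using e by blast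
      then have "card (live Y) < card (live X)" by (intro psubset_card_mono) simp_all
      moreover have "free X \<inter> Y = {}" using Y(4) by (fastforce simp: free_def live_def)
      then have "insert u (free X) \<subseteq> free Y" "u \<notin> free X"
        using Y(3,6) u(1) liveY(1) e by (auto simp: free_def live_def)
      then have "card (insert u (free X)) \<le> card (free Y)" "u \<notin> free X"
        using card_mono[of "free Y" "insert u (free X)"] by simp_all
      then have "Suc (card (free X)) \<le> card (free Y)" by (metis card_insert_disjoint finite_free)
      then have "d * card (free X) + d \<le> d * card (free Y)"
        by (metis mult_Suc_right add.commute mult_le_mono2)
      moreover have "card (Y - Z) \<le> card (X - Z) + card (Y - X)"
      proof -
        have "Y - Z = (X - Z) \<union> (Y - X)" using Y(2) X(2) by (auto simp: P_def)
        then show ?thesis by (simp add: card_Un_le)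
      qed
      ultimately have "P (Suc j) Y" using X(2) Y(2,5) ud by (auto simp: P_def)
      moreover have "killed Y (set0 ''i'' (Suc j) (run kill_neighbours t'))"
        by (rule killed_cong[OF Y(1)]) simp_all
      moreover have "run ?body t = run kill_neighbours t'" using False by (simp add: t'_def)
      ultimately show ?thesis by (auto simp: I_def)
    qed
  qed
  then have "I m (run greedy s)"
    using s unfolding greedy_def by (simp add: represents_def del: run.simps)
  then obtain X where X: "killed X (run greedy s)" "P m X" by (auto simp: I_def)
  then have sub: "X \<subseteq> {..<n}" and live: "live X = {}" by (auto simp: P_def killed_def)
  \<comment> \<open>Without live edges every alive vertex is free, so the potential becomes the size
    of the complement.\<close>
  from live have "free X = {..<n} - X" by (auto simp: free_def)
  then have "card (free X) = n - card X"
    using sub by (simp add: card_Diff_subset finite_subset)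
  with X live that[of X] show ?thesis by (simp add: P_def)
qed

end

section \<open>The complete program\<close>

definition load :: loop where
  "load = ''k'' :=: Read ''io'' (Const 0) ;; ''n'' :=: Read ''io'' (Const 1) ;; ''m'' :=: Read ''io'' (Const 2)"

text \<open>The code of one vertex without edges and with \<open>k = j\<close>: a yes-instance for 0
  and a no-instance for 2.\<close>

definition emit_trivial :: "nat \<Rightarrow> loop" where
  "emit_trivial j = Assign ''io'' (Const 0) (Const j) ;; Assign ''io'' (Const 1) (Const 1) ;;
     Assign ''io'' (Const 2) (Const 0) ;; ''len'' :=: Const 3"

text \<open>The kernel is written before \<open>greedy\<close> runs, because \<open>greedy\<close>
  goes on changing the flags \<open>x\<close> and \<open>d\<close> that select it.\<close>

definition main :: loop where
  "main = copy_matrix ;; kill_singletons ;; write_kernel ;; greedy ;; count_alive"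

text \<open>\<open>q = 0\<close> means either that all vertices were deleted, which would leave no
  legal hypergraph, or that there were no edges and \<open>q\<close> was never set. In both cases
  \<open>k > t\<close> settles the answer as no.\<close>

definition decide :: loop where
  "decide = Cond (Minus (V ''k'') (V ''t'')) (Cond (V ''q'') Nop (emit_trivial 2)) (emit_trivial 0)"

text \<open>Without edges, the number of vertices may be exponential in the length of the input, hence the
  detour around the loops.\<close>

definition kernelizer :: com where
  "kernelizer = Seq (compile load)
     (Seq (If (V ''m'') (compile main) (compile (''t'' :=: V ''n''))) (compile decide))"

lemma concat_map_nth:
  assumes "\<And>x. x \<in> set xs \<Longrightarrow> length (f x) = n" "i < length xs" "j < n"
  shows "concat (map f xs) ! (i * n + j) = f (xs ! i) ! j"
  using assms
proof (induction xs arbitrary: i)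
  case (Cons x xs)
  then show ?case by (cases i) (auto simp: nth_append)
qed simp

lemma length_concat_map:
  assumes "\<And>x. x \<in> set xs \<Longrightarrow> length (f x) = n"
  shows "length (concat (map f xs)) = length xs * n"
  using assms by (induction xs) auto

lemma (in incidence) run_main:
  assumes nm: "s ''n'' 0 = n" "s ''m'' 0 = m"
    and io: "\<And>e v. e < m \<Longrightarrow> v < n \<Longrightarrow> s ''io'' (3 + (e * n + v)) = of_bool (v \<in> F e)"
    and zero: "s ''x'' = (\<lambda>_. 0)" "s ''d'' = (\<lambda>_. 0)"
    and low: "low_degree d"
  defines "s' \<equiv> run main s"
  obtains Z X where "\<And>z. z \<in> Z \<Longrightarrow> \<exists>e<m. F e = {z}" "Z \<subseteq> X" "X \<subseteq> {..<n}" "live X = {}"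
    "card (X - Z) \<le> d * (n - card X)" "s' ''t'' 0 = n - card X" "s' ''q'' 0 = n - card Z"
    "output_of s' = [s ''io'' 0, n - card Z, card (live Z)] @
      concat (map (\<lambda>e. map (\<lambda>v. of_bool (v \<in> F e)) (filter (\<lambda>v. v \<notin> Z) [0..<n]))
        (filter (\<lambda>e. F e \<inter> Z = {}) [0..<m]))"
proof -
  define s1 where "s1 = run copy_matrix s"
  define s2 where "s2 = run kill_singletons s1"
  define s3 where "s3 = run write_kernel s2"
  define s4 where "s4 = run greedy s3"
  have s': "s' = run count_alive s4"
    by (simp add: s'_def main_def s1_def s2_def s3_def s4_def)
  have bound: "e * n + v < m * n" if "e < m" "v < n" for e v
  proof -
    have "e * n + v < Suc e * n" using that by simp
    also have "\<dots> \<le> m * n" using that by (intro mult_le_mono1) simp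
    finally show ?thesis .
  qed
  note copy = run_copy_matrix[where s = s, OF nm, folded s1_def]
  have "s1 ''b'' e = e * n" "s1 ''a'' (e * n + v) = of_bool (v \<in> F e)" if "e < m" "v < n" for e v
    using that copy(1)[of e] copy(2)[OF bound[OF that]] io[OF that] by simp_all
  then have s1: "represents s1"
    using nm by (simp add: represents_def entry_def s1_def run_frame)
  have s1_killed: "killed {} s1"
    using zero by (simp add: killed_def s1_def run_frame)
  obtain Z where Z: "killed Z s2" "\<And>z. z \<in> Z \<Longrightarrow> \<exists>e<m. F e = {z}"
    "\<And>e. e < m \<Longrightarrow> F e \<inter> Z = {} \<Longrightarrow> card (F e) \<ge> 2"
    using run_kill_singletons[OF s1 s1_killed, folded s2_def] by blast
  have s2: "represents s2" unfolding s2_def by (intro represents_run s1) simp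
  have s3: "represents s3" "killed Z s3"
    unfolding s3_def by (intro represents_run killed_run s2 Z; simp)+
  obtain X where X: "killed X s4" "Z \<subseteq> X" "live X = {}" "card (X - Z) \<le> d * (n - card X)"
    using run_greedy[OF s3 low Z(3), folded s4_def] by blast
  have s4: "represents s4" unfolding s4_def by (intro represents_run s3) simp
  have t: "s' ''t'' 0 = n - card X" unfolding s' by (rule run_count_alive[OF s4 X(1)])
  have Zn: "Z \<subseteq> {..<n}" using Z(1) by (simp add: killed_def)
  have "length (filter (\<lambda>v. v \<notin> Z) [0..<n]) = card ({..<n} - Z)"
    by (simp add: length_filter_conv_card) (rule arg_cong[of _ _ card], auto)
  then have vs: "length (filter (\<lambda>v. v \<notin> Z) [0..<n]) = n - card Z"
    using Zn by (simp add: card_Diff_subset finite_subset)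
  have es: "length (filter (\<lambda>e. F e \<inter> Z = {}) [0..<m]) = card (live Z)"
    unfolding live_def
    by (simp add: length_filter_conv_card) (rule arg_cong[of _ _ card], auto)
  have fr: "s' ''q'' = s3 ''q''" "s' ''io'' = s3 ''io''" "s' ''len'' = s3 ''len''"
    by (simp_all add: s' s4_def run_frame)
  have "s2 ''io'' 0 = s ''io'' 0" by (simp add: s2_def s1_def run_frame)
  with run_write_kernel[OF s2 Z(1), folded s3_def, unfolded vs es]
  have "s' ''q'' 0 = n - card Z"
    "output_of s' = [s ''io'' 0, n - card Z, card (live Z)] @
      concat (map (\<lambda>e. map (\<lambda>v. of_bool (v \<in> F e)) (filter (\<lambda>v. v \<notin> Z) [0..<n]))
        (filter (\<lambda>e. F e \<inter> Z = {}) [0..<m]))"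
    by (simp_all add: output_of_def fr)
  then show ?thesis using that[of Z X] Z(2) X t by (simp add: killed_def)
qed

section \<open>Degeneracy and the deletion of forced vertices\<close>

lemma degenerate_size: "degenerate (size (edges H)) H"
  unfolding degenerate_def
proof (intro allI impI)
  fix X assume "verts (H \<ominus> X) \<noteq> {}"
  then obtain v where v: "v \<in> verts (H \<ominus> X)" by blast
  have "vdegree (H \<ominus> X) v \<le> size (edges (H \<ominus> X))"
    unfolding vdegree_def by (intro size_mset_mono multiset_filter_subset)
  also have "\<dots> \<le> size (edges H)"
    unfolding hyper_minus_def by (simp add: size_filter_mset_lesseq)
  finally show "\<exists>v \<in> verts (H \<ominus> X). vdegree (H \<ominus> X) v \<le> size (edges H)" using v by blast
qed

text \<open>The number of edges is an admissible bound, so the least one is attained.\<close>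

lemma degenerate_degeneracy: "degenerate (degeneracy H) H"
  unfolding degeneracy_def by (rule LeastI[of "\<lambda>d. degenerate d H", OF degenerate_size])

lemma degeneracy_le_size: "degeneracy H \<le> size (edges H)"
  unfolding degeneracy_def by (rule Least_le[of "\<lambda>d. degenerate d H", OF degenerate_size])

text \<open>Leaving out \<open>is_hypergraph\<close> makes the notion apply to the vertexless
  structure that remains when everything is deleted.\<close>

definition solvable :: "'a hypergraph \<Rightarrow> nat \<Rightarrow> bool" where
  "solvable H k \<longleftrightarrow> (\<exists>S. hitting_set H S \<and> int (card S) \<le> int (card (verts H)) - int k)"

definition trivial_hypergraph :: "nat hypergraph" where
  "trivial_hypergraph = \<lparr>verts = {0}, edges = {#}\<rparr>"

lemma solvable_trivial: "solvable trivial_hypergraph k \<longleftrightarrow> k \<le> 1"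
proof
  assume "solvable trivial_hypergraph k"
  then show "k \<le> 1" by (auto simp: solvable_def trivial_hypergraph_def)
next
  assume "k \<le> 1"
  then show "solvable trivial_hypergraph k"
    by (auto simp: solvable_def trivial_hypergraph_def hitting_set_def intro!: exI[of _ "{}"])
qed

lemma code_trivial: "[k, 1, 0] \<in> hs_codes (trivial_hypergraph, k)"
  unfolding hs_codes_def trivial_hypergraph_def prod.case mem_Collect_eq
  by (rule exI[of _ "[0]"], rule exI[of _ "[]"]) simp

text \<open>Unlike \<open>\<ominus>\<close>, this keeps isolated vertices outside \<open>Z\<close>:
  they count towards \<open>n\<close>, so dropping them with the same \<open>k\<close> could change
  the answer.\<close>

definition delete_verts :: "'a hypergraph \<Rightarrow> 'a set \<Rightarrow> 'a hypergraph" where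
  "delete_verts H Z = \<lparr>verts = verts H - Z, edges = {#e \<in># edges H. e \<inter> Z = {}#}\<rparr>"

text \<open>Every hitting set of \<open>H\<close> contains \<open>Z\<close>, so adding or removing
  \<open>Z\<close> changes its size and the number of vertices by the same amount.\<close>

lemma solvable_delete_verts:
  assumes H: "is_hypergraph H" and Z: "\<And>z. z \<in> Z \<Longrightarrow> {z} \<in># edges H"
  shows "solvable (delete_verts H Z) k \<longleftrightarrow> solvable H k"
proof -
  have fin: "finite (verts H)" using H by (simp add: is_hypergraph_def)
  have ZV: "Z \<subseteq> verts H" using H Z by (fastforce simp: is_hypergraph_def)
  have finZ: "finite Z" using ZV fin finite_subset by blast
  have card: "int (card (verts (delete_verts H Z))) = int (card (verts H)) - int (card Z)"
    using card_mono[OF fin ZV] finZ ZV by (simp add: delete_verts_def card_Diff_subset of_nat_diff)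
  show ?thesis
  proof
    assume "solvable (delete_verts H Z) k"
    then obtain S where S: "hitting_set (delete_verts H Z) S"
      "int (card S) \<le> int (card (verts H)) - int (card Z) - int k"
      by (auto simp: solvable_def card)
    have "card (S \<union> Z) \<le> card S + card Z" by (rule card_Un_le)
    moreover have "hitting_set H (S \<union> Z)"
      using S(1) ZV by (fastforce simp: hitting_set_def delete_verts_def)
    ultimately show "solvable H k" using S(2) by (auto simp: solvable_def intro!: exI[of _ "S \<union> Z"])
  next
    assume "solvable H k"
    then obtain S where S: "hitting_set H S" "int (card S) \<le> int (card (verts H)) - int k"
      by (auto simp: solvable_def)
    have ZS: "Z \<subseteq> S" using S(1) Z by (fastforce simp: hitting_set_def)
    have finS: "finite S" using S(1) fin finite_subset by (auto simp: hitting_set_def)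
    have "int (card (S - Z)) = int (card S) - int (card Z)"
      using card_mono[OF finS ZS] finZ ZS by (simp add: card_Diff_subset of_nat_diff)
    moreover have "hitting_set (delete_verts H Z) (S - Z)"
      using S(1) by (fastforce simp: hitting_set_def delete_verts_def)
    ultimately show "solvable (delete_verts H Z) k"
      using S(2) by (auto simp: solvable_def card intro!: exI[of _ "S - Z"])
  qed
qed

section \<open>Coded hypergraphs\<close>

text \<open>One fixed code of \<open>H\<close>. As \<open>vs\<close> is distinct, passing to
  positions preserves cardinalities; \<open>es\<close> may repeat entries, one for each parallel
  edge.\<close>

locale coded_hypergraph =
  fixes H :: "nat hypergraph" and vs :: "nat list" and es :: "nat set list" and F :: "nat \<Rightarrow> nat set"
  assumes hypergraph: "is_hypergraph H" and distinct: "distinct vs" and verts: "set vs = verts H"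
    and edges: "mset es = edges H"
  defines "F \<equiv> \<lambda>e. {i. i < length vs \<and> vs ! i \<in> es ! e}"
begin

lemma mem_F: "i \<in> F e \<longleftrightarrow> i < length vs \<and> vs ! i \<in> es ! e"
  by (simp add: F_def)

lemma edge_props: "e < length es \<Longrightarrow> es ! e \<noteq> {} \<and> es ! e \<subseteq> set vs"
  using hypergraph nth_mem[of e es] by (simp add: is_hypergraph_def verts flip: edges)

sublocale incidence "length vs" "length es" F
proof
  fix e assume e: "e < length es"
  show "F e \<subseteq> {..<length vs}" by (auto simp: mem_F)
  from edge_props[OF e] obtain v where "v \<in> es ! e" "v \<in> set vs" by blast
  then show "F e \<noteq> {}" by (auto simp: mem_F in_set_conv_nth)
qed

lemma F_image: "e < length es \<Longrightarrow> (!) vs ` F e = es ! e"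
  using edge_props[of e] by (force simp: mem_F in_set_conv_nth)

lemma inj_on_vs: "X \<subseteq> {..<length vs} \<Longrightarrow> inj_on ((!) vs) X"
  by (rule inj_on_nth[OF distinct]) auto

lemma meets_iff:
  assumes "X \<subseteq> {..<length vs}" "e < length es"
  shows "es ! e \<inter> (!) vs ` X = {} \<longleftrightarrow> F e \<inter> X = {}"
proof -
  have "es ! e \<inter> (!) vs ` X = (!) vs ` (F e \<inter> X)"
    using inj_on_vs[of "F e \<union> X"] F_image[OF assms(2)] F_subset[OF assms(2)] assms(1)
    by (subst inj_on_image_Int[of _ "F e \<union> X"]) auto
  then show ?thesis by simp
qed

lemma size_edges_filter: "size {#e \<in># edges H. P e#} = card {e. e < length es \<and> P (es ! e)}"
  unfolding edges[symmetric] mset_filter[symmetric] size_mset length_filter_conv_card ..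

text \<open>A live edge leaves a vertex in \<open>H \<ominus> ?X\<close>, so degeneracy provides one
  of small degree. Surviving there means lying in an edge that misses \<open>?X\<close>, which makes
  the degree positive.\<close>

lemma low_degree_degeneracy: "low_degree (degeneracy H)"
  unfolding low_degree_def
proof (intro allI impI)
  fix X assume X: "X \<subseteq> {..<length vs}" "live X \<noteq> {}"
  let ?X = "(!) vs ` X"
  obtain e where e: "e < length es" "F e \<inter> X = {}" using X(2) by (auto simp: live_def)
  obtain v where "v \<in> es ! e" "v \<in> verts H" using edge_props[OF e(1)] verts by blast
  moreover have "es ! e \<in># edges H" using e(1) by (simp flip: edges)
  ultimately have "v \<in> verts (H \<ominus> ?X)"
    using meets_iff[OF X(1) e(1)] e(2) by (auto simp: hyper_minus_def)
  moreover have "?X \<subseteq> verts H" using X(1) by (auto simp flip: verts)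
  ultimately obtain v where v: "v \<in> verts (H \<ominus> ?X)" "vdegree (H \<ominus> ?X) v \<le> degeneracy H"
    using degenerate_degeneracy[of H] by (auto simp: degenerate_def)
  then have "v \<in> set vs" by (simp add: hyper_minus_def verts)
  then obtain i where i: "i < length vs" "v = vs ! i" by (auto simp: in_set_conv_nth)
  have "vdegree (H \<ominus> ?X) v = size {#e \<in># edges H. e \<inter> ?X = {} \<and> v \<in> e#}"
    by (simp add: vdegree_def hyper_minus_def filter_filter_mset conj_commute)
  also have "\<dots> = card {e. e < length es \<and> es ! e \<inter> ?X = {} \<and> v \<in> es ! e}"
    by (rule size_edges_filter)
  also have "{e. e < length es \<and> es ! e \<inter> ?X = {} \<and> v \<in> es ! e} = {e \<in> live X. i \<in> F e}"
    using meets_iff[OF X(1)] i by (auto simp: live_def mem_F)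
  finally have deg: "vdegree (H \<ominus> ?X) v = live_degree X i" by (simp add: live_degree_eq)
  obtain e' where "e' \<in># edges H" "v \<in> e'" "e' \<inter> ?X = {}"
    using v(1) by (auto simp: hyper_minus_def)
  obtain k where "k < length es" "es ! k = e'"
    using \<open>e' \<in># edges H\<close> by (auto simp: in_set_conv_nth simp flip: edges)
  then have "k \<in> live X" "i \<in> F k"
    using \<open>v \<in> e'\<close> \<open>e' \<inter> ?X = {}\<close> i meets_iff[OF X(1), of k] by (auto simp: live_def mem_F)
  then have "0 < live_degree X i" by (auto simp: live_degree_pos_iff)
  with i v(2) deg show "\<exists>i<length vs. 0 < live_degree X i \<and> live_degree X i \<le> degeneracy H" by auto
qed

lemma solvable_if_killed:
  assumes "X \<subseteq> {..<length vs}" "live X = {}" "k \<le> length vs - card X"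
  shows "solvable H k"
proof -
  have "card X \<le> length vs" using card_mono[OF _ assms(1)] by simp
  moreover have "card ((!) vs ` X) = card X" by (rule card_image[OF inj_on_vs[OF assms(1)]])
  moreover have "card (verts H) = length vs" using distinct_card[OF distinct] verts by simp
  moreover have "hitting_set H ((!) vs ` X)"
    unfolding hitting_set_def
  proof
    show "(!) vs ` X \<subseteq> verts H" using assms(1) by (auto simp flip: verts)
    show "\<forall>e \<in># edges H. (!) vs ` X \<inter> e \<noteq> {}"
    proof
      fix e' assume "e' \<in># edges H"
      then obtain e where "e < length es" "e' = es ! e"
        by (auto simp: in_set_conv_nth simp flip: edges)
      with assms(2) meets_iff[OF assms(1)] show "(!) vs ` X \<inter> e' \<noteq> {}" by (auto simp: live_def)
    qed
  qed
  ultimately show ?thesis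
    using assms(3) by (auto simp: solvable_def intro!: exI[of _ "(!) vs ` X"])
qed

context
  fixes Z
  assumes Z: "Z \<subseteq> {..<length vs}"
begin

abbreviation "reduced \<equiv> delete_verts H ((!) vs ` Z)"

text \<open>The orderings required of a code are inherited by filtering \<open>vs\<close> and
  \<open>es\<close>.\<close>

lemma kernel_code:
  "[k, length vs - card Z, card (live Z)] @
    concat (map (\<lambda>e. map (\<lambda>v. of_bool (v \<in> F e)) (filter (\<lambda>v. v \<notin> Z) [0..<length vs]))
      (filter (\<lambda>e. F e \<inter> Z = {}) [0..<length es])) \<in> hs_codes (reduced, k)"
proof -
  let ?I = "filter (\<lambda>v. v \<notin> Z) [0..<length vs]" and ?J = "filter (\<lambda>e. F e \<inter> Z = {}) [0..<length es]"
  let ?vs = "map ((!) vs) ?I" and ?es = "map ((!) es) ?J"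
  have I: "set ?I = {..<length vs} - Z" by auto
  have J: "set ?J = live Z" by (auto simp: live_def)
  have len: "length ?vs = length vs - card Z" "length ?es = card (live Z)"
    using distinct_card[of ?I] distinct_card[of ?J] Z
    unfolding I J by (simp_all add: card_Diff_subset finite_subset)
  have dist: "distinct ?vs" using inj_on_vs[of "set ?I"] by (subst distinct_map) auto
  have verts': "set ?vs = verts reduced"
  proof -
    have "set ?vs = (!) vs ` ({..<length vs} - Z)" by (simp add: I del: set_filter)
    also have "\<dots> = (!) vs ` {..<length vs} - (!) vs ` Z"
      using inj_on_image_set_diff[OF inj_on_vs[OF order_refl], of "{..<length vs}" Z] Z by simp
    also have "(!) vs ` {..<length vs} = verts H" by (auto simp: in_set_conv_nth simp flip: verts)
    finally show ?thesis by (simp add: delete_verts_def)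
  qed
  have edges': "mset ?es = edges reduced"
  proof -
    have "?es = filter (\<lambda>e. e \<inter> (!) vs ` Z = {}) (map ((!) es) [0..<length es])"
      using meets_iff[OF Z] by (auto simp: filter_map intro!: arg_cong[of _ _ "map _"] filter_cong)
    then show ?thesis by (simp add: delete_verts_def map_nth flip: edges)
  qed
  have rows: "map (\<lambda>e. map (\<lambda>v. of_bool (v \<in> e)) ?vs) ?es =
      (map (\<lambda>e. map (\<lambda>v. of_bool (v \<in> F e)) ?I) ?J :: nat list list)"
    by (auto simp: mem_F)
  show ?thesis
    unfolding hs_codes_def prod.case mem_Collect_eq len[symmetric] rows[symmetric]
    by (rule exI[of _ ?vs], rule exI[of _ ?es]) (intro conjI refl dist verts' edges')
qed

lemma card_verts_kernel: "card (verts reduced) = length vs - card Z"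
proof -
  have "(!) vs ` Z \<subseteq> verts H" using Z by (auto simp flip: verts)
  then have "card (verts reduced) = card (verts H) - card ((!) vs ` Z)"
    using Z by (simp add: delete_verts_def card_Diff_subset finite_subset)
  then show ?thesis
    using distinct_card[OF distinct] verts card_image[OF inj_on_vs[OF Z]] by simp
qed

lemma size_edges_kernel: "size (edges reduced) = card (live Z)"
  using meets_iff[OF Z]
  by (auto simp: delete_verts_def size_edges_filter live_def intro!: arg_cong[of _ _ card])

lemma kernel_hypergraph:
  assumes "card Z < length vs"
  shows "is_hypergraph reduced"
proof -
  have "card (verts reduced) \<noteq> 0" using assms card_verts_kernel by simp
  then have "verts reduced \<noteq> {}" "finite (verts reduced)" by (auto intro: card_ge_0_finite)
  then show ?thesis using hypergraph by (auto simp: is_hypergraph_def delete_verts_def)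
qed

lemma solvable_kernel:
  assumes "\<And>z. z \<in> Z \<Longrightarrow> \<exists>e<length es. F e = {z}"
  shows "solvable reduced k \<longleftrightarrow> solvable H k"
proof (rule solvable_delete_verts[OF hypergraph])
  fix z assume "z \<in> (!) vs ` Z"
  then obtain i where "i \<in> Z" "z = vs ! i" by blast
  moreover from assms[OF this(1)] obtain e where "e < length es" "F e = {i}" by blast
  ultimately have "e < length es" "es ! e = {z}" using F_image[of e] by auto
  then have "{z} \<in> set es" by (metis nth_mem)
  then show "{z} \<in># edges H" by (simp flip: edges)
qed

end

end

section \<open>Size and running time\<close>

lemma floorlog_le_self: "floorlog 2 x \<le> x"
  by (rule floorlog_leI) simp_all

lemma bit_size_append: "bit_size (xs @ ys) = bit_size xs + bit_size ys"
  by (simp add: bit_size_def)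

lemma floorlog_le_bit_size: "x \<in> set xs \<Longrightarrow> floorlog 2 x + 1 \<le> bit_size xs"
  unfolding bit_size_def by (rule member_le_sum_list) auto

lemma length_le_bit_size: "length xs \<le> bit_size xs"
  unfolding bit_size_def by (induction xs) auto

lemma bit_size_bits: "(\<And>x. x \<in> set xs \<Longrightarrow> x \<le> 1) \<Longrightarrow> bit_size xs \<le> 2 * length xs"
proof (induction xs)
  case (Cons x xs)
  have "floorlog 2 x \<le> 1" using floorlog_le_self[of x] Cons.prems[of x] by simp
  with Cons show ?case by (simp add: bit_size_def)
qed (simp add: bit_size_def)

lemma hs_codesE:
  assumes "xs \<in> hs_codes (H, k)"
  obtains vs es where "xs = [k, length vs, length es] @
      concat (map (\<lambda>e. map (\<lambda>v. of_bool (v \<in> e)) vs) es)"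
    "distinct vs" "set vs = verts H" "mset es = edges H"
    "length vs = card (verts H)" "length es = size (edges H)"
proof -
  from assms obtain vs es where *: "xs = [k, length vs, length es] @
      concat (map (\<lambda>e. map (\<lambda>v. of_bool (v \<in> e)) vs) es)"
    "distinct vs" "set vs = verts H" "mset es = edges H"
    by (auto simp: hs_codes_def)
  with that[OF *] show ?thesis using distinct_card[OF *(2)] size_mset[of es] by simp
qed

lemma length_code: "xs \<in> hs_codes (H, k) \<Longrightarrow> length xs = 3 + size (edges H) * card (verts H)"
  by (erule hs_codesE) (simp add: length_concat_map[of _ _ "card (verts H)"])

text \<open>Only \<open>k\<close> keeps its logarithm, because its value may be exponential in the
  input length. A matrix entry costs at most one digit and one separator; the 3 is for the
  separators of the header.\<close>

lemma bit_size_code: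
  assumes "xs \<in> hs_codes (H, k)"
  shows "bit_size xs \<le> floorlog 2 k + card (verts H) + size (edges H)
    + 2 * (size (edges H) * card (verts H)) + 3"
proof -
  from assms obtain vs es where xs: "xs = [k, length vs, length es] @
      concat (map (\<lambda>e. map (\<lambda>v. of_bool (v \<in> e)) vs) es)"
    and "distinct vs" "set vs = verts H" "mset es = edges H"
    and len: "length vs = card (verts H)" "length es = size (edges H)"
    by (rule hs_codesE)
  let ?bits = "concat (map (\<lambda>e. map (\<lambda>v. of_bool (v \<in> e)) vs) es) :: nat list"
  have "bit_size ?bits \<le> 2 * length ?bits" by (rule bit_size_bits) auto
  also have "length ?bits = size (edges H) * card (verts H)"
    by (simp add: length_concat_map[of _ _ "card (verts H)"] len)
  finally show ?thesis
    using floorlog_le_self[of "length vs"] floorlog_le_self[of "length es"]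
    unfolding xs bit_size_append by (simp add: bit_size_def len)
qed

text \<open>Collects what the estimates of output length, size and parameter use. The last conjunct
  makes the matrix nonempty, so that the input length dominates the number of vertices.\<close>

definition small_instance :: "nat hypergraph \<Rightarrow> nat \<Rightarrow> nat hypergraph \<Rightarrow> nat \<Rightarrow> bool" where
  "small_instance H k H' k' \<longleftrightarrow>
     (H' = trivial_hypergraph \<and> k' \<le> 2) \<or>
     (k' = k \<and> card (verts H') \<le> card (verts H) \<and> size (edges H') \<le> size (edges H) \<and>
      card (verts H') < (degeneracy H + 1) * k \<and>
      size (edges H') \<le> degeneracy H * card (verts H') \<and> 0 < size (edges H))"

lemma output_of_emit_trivial: "output_of (run (emit_trivial j) s) = [j, 1, 0]"
  by (simp add: emit_trivial_def output_of_def upt_rec)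

lemma run_decide:
  assumes "s ''k'' 0 = k" "s ''t'' 0 = t" "s ''q'' 0 = q"
  shows "output_of (run decide s) =
    (if k \<le> t then [0, 1, 0] else if q = 0 then [2, 1, 0] else output_of s)"
  using assms by (simp add: decide_def output_of_emit_trivial del: run.simps(3))

lemma trivial_answer:
  assumes "solvable H k \<longleftrightarrow> j = 0" "j = 0 \<or> j = 2" "ys = [j, 1, 0]"
  shows "\<exists>H' k'. is_hypergraph H' \<and> ys \<in> hs_codes (H', k') \<and>
    (solvable H k \<longleftrightarrow> solvable H' k') \<and> small_instance H k H' k'"
proof (intro exI conjI)
  show "is_hypergraph trivial_hypergraph" by (simp add: is_hypergraph_def trivial_hypergraph_def)
  show "ys \<in> hs_codes (trivial_hypergraph, j)" using assms(3) code_trivial by simp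
  show "solvable H k \<longleftrightarrow> solvable trivial_hypergraph j" using assms(1,2) by (auto simp: solvable_trivial)
  show "small_instance H k trivial_hypergraph j" using assms(2) by (auto simp: small_instance_def)
qed

lemma kernelizer_correct:
  assumes H: "is_hypergraph H" and xs: "xs \<in> hs_codes (H, k)"
  shows "\<exists>t s H' k'. exec kernelizer (input_state xs) t s \<and> t \<le> time (bit_size xs) main + 200 \<and>
    is_hypergraph H' \<and> output_of s \<in> hs_codes (H', k') \<and>
    (solvable H k \<longleftrightarrow> solvable H' k') \<and> small_instance H k H' k'"
proof -
  from xs obtain vs es where xs_eq: "xs = [k, length vs, length es] @
      concat (map (\<lambda>e. map (\<lambda>v. of_bool (v \<in> e)) vs) es)"
    and H_eq: "distinct vs" "set vs = verts H" "mset es = edges H"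
    and len: "length vs = card (verts H)" "length es = size (edges H)"
    by (rule hs_codesE)
  let ?n = "length vs" and ?m = "length es"
  have n: "?n > 0" using H len by (simp add: is_hypergraph_def card_gt_0_iff)
  define s0 where "s0 = input_state xs"
  define s1 where "s1 = run load s0"
  define p where "p = (if ?m = 0 then ''t'' :=: V ''n'' else main)"
  define s2 where "s2 = run p s1"
  define s3 where "s3 = run decide s2"
  have io: "s0 ''io'' i = xs ! i" if "i < length xs" for i
    using that by (simp add: s0_def input_state_def)
  have s1: "s1 ''k'' 0 = k" "s1 ''n'' 0 = ?n" "s1 ''m'' 0 = ?m"
    using io[of 0] io[of 1] io[of 2] by (simp_all add: s1_def load_def xs_eq)
  have k: "s2 ''k'' 0 = k" using s1(1) by (simp add: s2_def p_def main_def run_frame del: run.simps)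
  \<comment> \<open>\<open>load\<close> and \<open>decide\<close> contain no loops, so 0 may serve
    as the bound \<open>B\<close>.\<close>
  have "\<exists>t \<le> time 0 load. exec (compile load) s0 t s1"
    unfolding s1_def by (rule exec_compile) (simp_all add: load_def)
  then obtain t1 where t1: "t1 \<le> time 0 load" "exec (compile load) s0 t1 s1" by blast
  have "\<exists>t \<le> time (bit_size xs) p. exec (compile p) s1 t s2"
  proof (cases "?m = 0")
    case True
    show ?thesis unfolding s2_def by (rule exec_compile) (simp_all add: p_def True)
  next
    case False
    have "?n \<le> ?m * ?n" "?m \<le> ?m * ?n" using False n by (simp_all add: Suc_le_eq)
    moreover have "?m * ?n \<le> bit_size xs"
      using length_le_bit_size[of xs] length_code[OF xs] len by simp
    ultimately have le: "?n \<le> bit_size xs" "?m \<le> bit_size xs" by linarith+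
    have wf: "wf_loop main" by (simp add: main_def program_defs)
    have bounds: "bounds main = {''m'', ''n''}" by (auto simp: main_def program_defs)
    have disjoint: "bounds main \<inter> writes main = {}" unfolding bounds by (simp add: main_def)
    show ?thesis unfolding s2_def p_def if_not_P[OF False]
      by (rule exec_compile[OF wf disjoint]) (use le in \<open>simp add: bounds s1\<close>)
  qed
  then obtain t2 where t2: "t2 \<le> time (bit_size xs) p" "exec (compile p) s1 t2 s2" by blast
  have "\<exists>t \<le> time 0 decide. exec (compile decide) s2 t s3"
    unfolding s3_def by (rule exec_compile) (simp_all add: decide_def emit_trivial_def)
  then obtain t3 where t3: "t3 \<le> time 0 decide" "exec (compile decide) s2 t3 s3" by blast
  have "exec (If (V ''m'') (compile main) (compile (''t'' :=: V ''n''))) s1 (1 + cost (V ''m'') + t2) s2"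
    using t2(2) exec.IfTrue[of "V ''m''" s1] exec.IfFalse[of "V ''m''" s1]
    by (cases "?m = 0") (simp_all add: p_def s1)
  from exec.Seq[OF t1(2) exec.Seq[OF this t3(2)]]
  have exec: "exec kernelizer (input_state xs) (1 + t1 + (1 + (1 + cost (V ''m'') + t2) + t3)) s3"
    by (simp add: kernelizer_def s0_def)
  \<comment> \<open>The 4 is the cost of the single assignment used without edges; 200 generously
    covers \<open>load\<close>, \<open>decide\<close> and the control flow.\<close>
  have "time (bit_size xs) p \<le> time (bit_size xs) main + 4" by (simp add: p_def)
  with t1(1) t2(1) t3(1)
  have time: "1 + t1 + (1 + (1 + cost (V ''m'') + t2) + t3) \<le> time (bit_size xs) main + 200"
    by (simp add: load_def decide_def emit_trivial_def)
  have "\<exists>H' k'. is_hypergraph H' \<and> output_of s3 \<in> hs_codes (H', k') \<and>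
    (solvable H k \<longleftrightarrow> solvable H' k') \<and> small_instance H k H' k'"
  proof (cases "?m = 0")
    case True
    have t: "s2 ''t'' 0 = ?n" using s1 True by (simp add: s2_def p_def)
    have q: "s2 ''q'' 0 = 0"
      using True by (simp add: s2_def p_def s1_def load_def s0_def input_state_def)
    have "edges H = {#}" using len True by simp
    then have "solvable H k \<longleftrightarrow> k \<le> ?n"
      by (auto simp: solvable_def hitting_set_def len intro!: exI[of _ "{}"])
    moreover have "output_of s3 = (if k \<le> ?n then [0, 1, 0] else [2, 1, 0])"
      unfolding s3_def run_decide[where s = s2, OF k t q] by simp
    ultimately show ?thesis by (intro trivial_answer[of _ _ "if k \<le> ?n then 0 else 2"]) auto
  next
    case False
    define F where "F = (\<lambda>e. {i. i < ?n \<and> vs ! i \<in> es ! e})"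
    interpret coded_hypergraph H vs es F
      by unfold_locales (simp_all add: H H_eq F_def)
    have xs_io: "s1 ''io'' (3 + (e * ?n + v)) = of_bool (v \<in> F e)" if "e < ?m" "v < ?n" for e v
    proof -
      let ?rows = "concat (map (\<lambda>e. map (\<lambda>v. of_bool (v \<in> e)) vs) es) :: nat list"
      have "e * ?n + v < Suc e * ?n" using that by simp
      also have "\<dots> \<le> ?m * ?n" using that by (intro mult_le_mono1) simp
      finally have "3 + (e * ?n + v) < length xs" using length_code[OF xs] len by simp
      then have "s0 ''io'' (3 + (e * ?n + v)) = ?rows ! (e * ?n + v)"
        using io by (simp add: xs_eq)
      also have "\<dots> = of_bool (v \<in> F e)"
        using that by (subst concat_map_nth) (simp_all add: F_def)
      finally show ?thesis by (simp add: s1_def load_def)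
    qed
    have zero: "s1 ''x'' = (\<lambda>_. 0)" "s1 ''d'' = (\<lambda>_. 0)"
      by (auto simp: s1_def load_def s0_def input_state_def)
    have s1_io: "s1 ''io'' 0 = k"
      using io[of 0] by (simp add: s1_def load_def xs_eq)
    have s2: "s2 = run main s1" using False by (simp add: s2_def p_def)
    let ?d = "degeneracy H"
    obtain Z X where Z: "\<And>z. z \<in> Z \<Longrightarrow> \<exists>e<?m. F e = {z}" "Z \<subseteq> X"
      and X: "X \<subseteq> {..<?n}" "live X = {}" "card (X - Z) \<le> ?d * (?n - card X)"
      and t: "s2 ''t'' 0 = ?n - card X" and q: "s2 ''q'' 0 = ?n - card Z"
      and out: "output_of s2 = [k, ?n - card Z, card (live Z)] @
        concat (map (\<lambda>e. map (\<lambda>v. of_bool (v \<in> F e)) (filter (\<lambda>v. v \<notin> Z) [0..<?n]))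
          (filter (\<lambda>e. F e \<inter> Z = {}) [0..<?m]))"
      using run_main[OF s1(2,3) xs_io zero low_degree_degeneracy] unfolding s2 s1_io by blast
    have Zn: "Z \<subseteq> {..<?n}" using Z(2) X(1) by blast
    have cZ: "card Z \<le> ?n" using card_mono[OF _ Zn] by simp
    have out3: "output_of s3 = (if k \<le> ?n - card X then [0, 1, 0]
        else if ?n - card Z = 0 then [2, 1, 0] else output_of s2)"
      unfolding s3_def by (rule run_decide[where s = s2, OF k t q])
    consider (yes) "k \<le> ?n - card X" | (no) "\<not> k \<le> ?n - card X" "?n - card Z = 0"
      | (kernel) "\<not> k \<le> ?n - card X" "?n - card Z \<noteq> 0" by blast
    then show ?thesis
    proof cases
      case yes
      then show ?thesis
        using solvable_if_killed[OF X(1,2)] out3 by (intro trivial_answer[of _ _ 0]) auto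
    next
      case no
      \<comment> \<open>Here \<open>k\<close> is positive, as it exceeds \<open>?n - card X\<close>,
        so a structure without vertices is not solvable.\<close>
      have "verts (delete_verts H ((!) vs ` Z)) = {}"
        using card_verts_kernel[OF Zn] no(2) H by (simp add: delete_verts_def is_hypergraph_def)
      then have "\<not> solvable (delete_verts H ((!) vs ` Z)) k" using no(1) by (auto simp: solvable_def)
      then have "\<not> solvable H k" using solvable_kernel[OF Zn Z(1)] by simp
      with no show ?thesis using out3 by (intro trivial_answer[of _ _ 2]) auto
    next
      case kernel
      let ?H = "delete_verts H ((!) vs ` Z)"
      have cV: "card (verts ?H) = ?n - card Z" by (rule card_verts_kernel[OF Zn])
      have "?n - card Z \<le> (?n - card X) + card (X - Z)"
        using Z(2) card_Diff_subset[of Z X] card_mono[of X Z] X(1) Zn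
        by (simp add: finite_subset)
      also have "\<dots> \<le> (?d + 1) * (?n - card X)" using X(3) by simp
      also have "\<dots> < (?d + 1) * k" using kernel(1) by (intro mult_strict_left_mono) simp_all
      finally have small: "?n - card Z < (?d + 1) * k" .
      have "card (live Z) \<le> card {..<?m}" by (intro card_mono) (auto simp: live_def)
      then have "small_instance H k ?H k"
        using small card_live_le[OF low_degree_degeneracy Zn] False size_edges_kernel[OF Zn] cV len
        by (simp add: small_instance_def flip: nonempty_has_size)
      moreover have "is_hypergraph ?H" using kernel(2) by (intro kernel_hypergraph[OF Zn]) simp
      moreover have "output_of s3 \<in> hs_codes (?H, k)"
        using out3 kernel kernel_code[OF Zn, of k] out by simp
      moreover have "solvable H k \<longleftrightarrow> solvable ?H k" using solvable_kernel[OF Zn Z(1)] by simp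
      ultimately show ?thesis by blast
    qed
  qed
  with exec time show ?thesis by blast
qed

text \<open>A trivial instance takes at most 6 bits. Otherwise there are edges, and each of
  \<open>floorlog 2 k\<close>, the number of vertices, the number of edges and, counted twice, the
  number of matrix entries is at most the input length, which gives the factor 5.\<close>

lemma bit_size_output:
  assumes xs: "xs \<in> hs_codes (H, k)" and H: "is_hypergraph H"
    and ys: "ys \<in> hs_codes (H', k')" and small: "small_instance H k H' k'"
  shows "bit_size ys \<le> 5 * bit_size xs + 6"
  using small unfolding small_instance_def
proof (elim disjE conjE)
  assume "H' = trivial_hypergraph" "k' \<le> 2"
  then show ?thesis
    using bit_size_code[OF ys] floorlog_le_self[of k'] by (simp add: trivial_hypergraph_def)
next
  assume *: "k' = k" "card (verts H') \<le> card (verts H)" "size (edges H') \<le> size (edges H)"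
    "0 < size (edges H)"
  have "k \<in> set xs" using xs by (rule hs_codesE) simp
  then have "floorlog 2 k + 1 \<le> bit_size xs" by (rule floorlog_le_bit_size)
  moreover have "size (edges H) * card (verts H) + 3 \<le> bit_size xs"
    using length_le_bit_size[of xs] length_code[OF xs] by simp
  moreover have "card (verts H) \<le> size (edges H) * card (verts H)" using *(4) by simp
  moreover have "0 < card (verts H)" using H by (simp add: is_hypergraph_def card_gt_0_iff)
  then have "size (edges H) \<le> size (edges H) * card (verts H)" by simp
  moreover have "size (edges H') * card (verts H') \<le> size (edges H) * card (verts H)"
    by (intro mult_le_mono *)
  ultimately show ?thesis using bit_size_code[OF ys, unfolded *(1)] *(2,3) by linarith
qed

text \<open>Everything is expressed in the parameter \<open>p\<close> alone. The summand 1 in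
  \<open>N\<close> and the 2 in \<open>p + 2\<close> cover the trivial instances.\<close>

lemma small_instance_bounds:
  fixes H :: "nat hypergraph" and k :: nat
  defines "p \<equiv> k + degeneracy H"
  defines "N \<equiv> (p + 1) * p + 1"
  assumes "small_instance H k H' k'"
  shows "k' \<le> p + 2" "card (verts H') \<le> N" "size (edges H') \<le> p * N"
proof -
  have "(degeneracy H + 1) * k \<le> (p + 1) * p" by (intro mult_le_mono) (simp_all add: p_def)
  then have N: "(degeneracy H + 1) * k \<le> N" by (simp add: N_def)
  have V: "card (verts H') \<le> N"
    using assms(3) N by (auto simp: small_instance_def trivial_hypergraph_def N_def)
  have "degeneracy H * card (verts H') \<le> p * N" using V by (intro mult_le_mono) (simp_all add: p_def)
  then show "k' \<le> p + 2" "card (verts H') \<le> N" "size (edges H') \<le> p * N"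
    using V assms(3) by (auto simp: small_instance_def trivial_hypergraph_def p_def)
qed

(* A hypergraph has at least one vertex and at least zero edges, so the strict bounds cannot be
   met when they equal at most 1 and 0, respectively; they are claimed in all other cases,
   in particular whenever k and the degeneracy d are positive. *)
theorem theorem5:
  "\<exists>c :: com. kernelization hs_problem
     (\<lambda>(H, k) (H', k'). let d = degeneracy H in
        ((d + 1) * k > 1 \<longrightarrow> card (verts H') < (d + 1) * k) \<and>
        (d * (d + 1) * k > 0 \<longrightarrow> size (edges H') < d * (d + 1) * k)) c"
  unfolding kernelization_def
proof (intro exI[of _ kernelizer] conjI)
  obtain p where p: "\<And>B. time B main = poly p B" using time_poly[of main] by blast
  show "polytime_on kernelizer (\<Union>I \<in> instances hs_problem. codes hs_problem I)"
    unfolding polytime_on_def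
  \<comment> \<open>200 steps besides \<open>main\<close>, plus output length at most 5 times the
    input length plus 6.\<close>
  proof (intro exI[of _ "p + [:206, 5:]"] ballI)
    fix xs assume "xs \<in> (\<Union>I \<in> instances hs_problem. codes hs_problem I)"
    then obtain H :: "nat hypergraph" and k where H: "is_hypergraph H" "xs \<in> hs_codes (H, k)"
      by (auto simp: hs_problem_def)
    from kernelizer_correct[OF this] obtain t s H' k' where
      s: "exec kernelizer (input_state xs) t s" "t \<le> time (bit_size xs) main + 200"
      "output_of s \<in> hs_codes (H', k')" "small_instance H k H' k'" by blast
    have "t + bit_size (output_of s) \<le> poly (p + [:206, 5:]) (bit_size xs)"
      using s(2) bit_size_output[OF H(2,1) s(3,4)] by (simp add: p)
    with s(1) show "\<exists>t s. exec kernelizer (input_state xs) t s \<and>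
      t + bit_size (output_of s) \<le> poly (p + [:206, 5:]) (bit_size xs)" by blast
  qed
next
  let ?N = "\<lambda>p :: nat. (p + 1) * p + 1"
  \<comment> \<open>The degeneracy of the kernel is bounded by its number of edges, at most
    \<open>p * ?N p\<close>. \<open>?g\<close> is the estimate of \<open>bit_size_code\<close> with
    all bounds inserted.\<close>
  let ?f = "\<lambda>p. p + 2 + p * ?N p"
  let ?g = "\<lambda>p. p + 2 + ?N p + p * ?N p + 2 * (p * ?N p * ?N p) + 3"
  show "\<exists>f g. \<forall>I \<in> instances hs_problem. \<forall>xs \<in> codes hs_problem I.
      \<exists>t s. \<exists>I' \<in> instances hs_problem. exec kernelizer (input_state xs) t s \<and>
        output_of s \<in> codes hs_problem I' \<and>
        (I \<in> yes_instances hs_problem \<longleftrightarrow> I' \<in> yes_instances hs_problem) \<and>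
        parameter hs_problem I' \<le> f (parameter hs_problem I) \<and>
        bit_size (output_of s) \<le> g (parameter hs_problem I) \<and>
        (case I of (H, k) \<Rightarrow> \<lambda>(H', k'). let d = degeneracy H in
          ((d + 1) * k > 1 \<longrightarrow> card (verts H') < (d + 1) * k) \<and>
          (d * (d + 1) * k > 0 \<longrightarrow> size (edges H') < d * (d + 1) * k)) I'"
  proof (rule exI[of _ ?f], rule exI[of _ ?g], intro ballI)
    fix I xs assume "I \<in> instances hs_problem" "xs \<in> codes hs_problem I"
    then obtain H k where I: "I = (H, k)" and H: "is_hypergraph H" "xs \<in> hs_codes (H, k)"
      by (auto simp: hs_problem_def)
    from kernelizer_correct[OF H] obtain t s H' k' where
      s: "exec kernelizer (input_state xs) t s" "is_hypergraph H'"
      "output_of s \<in> hs_codes (H', k')" "solvable H k \<longleftrightarrow> solvable H' k'"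
      and small: "small_instance H k H' k'" by blast
    let ?d = "degeneracy H"
    let ?p = "k + ?d"
    note b = small_instance_bounds[OF small]
    have "k' + degeneracy H' \<le> ?f ?p" using b(1,3) degeneracy_le_size[of H'] by linarith
    moreover have "bit_size (output_of s) \<le> ?g ?p"
      using bit_size_code[OF s(3)] floorlog_le_self[of k'] b mult_le_mono[OF b(3,2)] by linarith
    moreover have "card (verts H') < (?d + 1) * k" if "(?d + 1) * k > 1"
      using small that by (auto simp: small_instance_def trivial_hypergraph_def)
    moreover have "size (edges H') < ?d * (?d + 1) * k" if pos: "?d * (?d + 1) * k > 0"
      using small unfolding small_instance_def
    proof (elim disjE conjE)
      assume "H' = trivial_hypergraph"
      then show ?thesis using pos by (simp add: trivial_hypergraph_def)
    next
      assume "card (verts H') < (?d + 1) * k" "size (edges H') \<le> ?d * card (verts H')"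
      moreover have "0 < ?d" using pos by simp
      ultimately show ?thesis
        by (metis le_less_trans mult.assoc mult_less_mono2)
    qed
    ultimately show "\<exists>t s. \<exists>I' \<in> instances hs_problem. exec kernelizer (input_state xs) t s \<and>
        output_of s \<in> codes hs_problem I' \<and>
        (I \<in> yes_instances hs_problem \<longleftrightarrow> I' \<in> yes_instances hs_problem) \<and>
        parameter hs_problem I' \<le> ?f (parameter hs_problem I) \<and>
        bit_size (output_of s) \<le> ?g (parameter hs_problem I) \<and>
        (case I of (H, k) \<Rightarrow> \<lambda>(H', k'). let d = degeneracy H in
          ((d + 1) * k > 1 \<longrightarrow> card (verts H') < (d + 1) * k) \<and>
          (d * (d + 1) * k > 0 \<longrightarrow> size (edges H') < d * (d + 1) * k)) I'"
      using s H(1)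
      by (intro exI[of _ t] exI[of _ s] bexI[of _ "(H', k')"])
        (simp_all add: I hs_problem_def solvable_def Let_def)
  qed
qed

end
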